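(* There is a faithful embedding of $\mathbf{Set}_F$ into $\mathbf{Pfn}_F$ which sends each $F$-coalgebra to itself and sends the $F$-coalgebra morphism $\varphi:A\to B$ to the equivalence class $\{1_A,\varphi\}$. The product $\times$ on $\mathbf{Set}_F$ extends to the bifunctor $\boxtimes$ on $\mathbf{Pfn}_F$ given by $X\boxtimes Y=X\times Y$ on objects and $\{m,\varphi\}\boxtimes\{m',\varphi'\}=\{m\times m',\varphi\times\varphi'\}$ on partial morphisms.
   Context: $F$ is an endofunctor on $\mathbf{Set}$. An $F$-coalgebra is a set $A$ with a map $\alpha:A\to FA$; a morphism $(A,\alpha)\to(B,\beta)$ is a map $\varphi$ with $\beta\varphi=F(\varphi)\alpha$; these form $\mathbf{Set}_F$. A subcoalgebra of $A$ is a subset carrying a (necessarily unique) coalgebra structure making the inclusion a morphism. Standing assumptions: $F$ is nontrivial ($FX=\emptyset$ implies $X=\emptyset$), weakly preserves pullbacks (sends pullback squares to squares having the pullback property except possibly uniqueness), and is either bounded (there is a cardinal $\kappa$ such that every element of every coalgebra lies in a subcoalgebra of cardinality at most $\kappa$) or accessible (preserves $\kappa$-filtered colimits for some $\kappa$). Then $\mathbf{Set}_F$ is complete and its monomorphisms are exactly the injective morphisms. $\mathbf{Pfn}_F$ is the category with the $F$-coalgebras as objects, in which a morphism (partial morphism) $X\to Y$ is an equivalence class $\{m,\varphi\}$ of pairs with $m:U\to X$ a monomorphism and $\varphi:U\to Y$ a morphism of $\mathbf{Set}_F$, where $(m,\varphi)\sim(m',\varphi')$ if $m=m'\theta$ and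 $\varphi=\varphi'\theta$ for an isomorphism $\theta$. Composition is by pullback: $\{m',\varphi'\}\circ\{m,\varphi\}=\{mq,\varphi'r\}$, where $q,r$ are the projections of the pullback of $\varphi$ and $m'$ (with $q$ the pullback of $m'$). The identity of $A$ is $\{1_A,1_A\}$. *)

theory Defs
  imports Main "HOL-Library.FuncSet"
begin

unbundle cardinal_syntax

section \<open>Categories, functors and limits\<close>

record ('o, 'a) cat =
  Ob :: "'o set"
  Ar :: "'a set"
  Dom :: "'a \<Rightarrow> 'o"
  Cod :: "'a \<Rightarrow> 'o"
  Ide :: "'o \<Rightarrow> 'a"
  Cmp :: "'a \<Rightarrow> 'a \<Rightarrow> 'a" (infixl "\<cdot>\<index>" 70)

definition Hom :: "('o, 'a) cat \<Rightarrow> 'o \<Rightarrow> 'o \<Rightarrow> 'a set" where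
  "Hom C X Y = {f \<in> Ar C. Dom C f = X \<and> Cod C f = Y}"

locale category =
  fixes C :: "('o, 'a) cat" (structure)
  assumes Dom_in: "f \<in> Ar C \<Longrightarrow> Dom C f \<in> Ob C"
    and Cod_in: "f \<in> Ar C \<Longrightarrow> Cod C f \<in> Ob C"
    and Ide_in: "X \<in> Ob C \<Longrightarrow> Ide C X \<in> Hom C X X"
    and Cmp_in: "f \<in> Hom C X Y \<Longrightarrow> g \<in> Hom C Y Z \<Longrightarrow> g \<cdot> f \<in> Hom C X Z"
    and Cmp_Ide: "f \<in> Hom C X Y \<Longrightarrow> f \<cdot> Ide C X = f"
    and Ide_Cmp: "f \<in> Hom C X Y \<Longrightarrow> Ide C Y \<cdot> f = f"
    and Cmp_assoc: "f \<in> Hom C W X \<Longrightarrow> g \<in> Hom C X Y \<Longrightarrow> h \<in> Hom C Y Z \<Longrightarrow>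
      (h \<cdot> g) \<cdot> f = h \<cdot> (g \<cdot> f)"

record ('o, 'a, 'p, 'b) func =
  onOb :: "'o \<Rightarrow> 'p"
  onAr :: "'a \<Rightarrow> 'b"

locale cat_functor = C: category C + D: category D
  for C :: "('o, 'a) cat" and D :: "('p, 'b) cat" +
  fixes F :: "('o, 'a, 'p, 'b) func"
  assumes onOb_in: "X \<in> Ob C \<Longrightarrow> onOb F X \<in> Ob D"
    and onAr_in: "f \<in> Hom C X Y \<Longrightarrow> onAr F f \<in> Hom D (onOb F X) (onOb F Y)"
    and onAr_Ide: "X \<in> Ob C \<Longrightarrow> onAr F (Ide C X) = Ide D (onOb F X)"
    and onAr_Cmp: "f \<in> Hom C X Y \<Longrightarrow> g \<in> Hom C Y Z \<Longrightarrow>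
      onAr F (g \<cdot>\<^bsub>C\<^esub> f) = onAr F g \<cdot>\<^bsub>D\<^esub> onAr F f"

definition func_comp ::
    "('p, 'b, 'q, 'c) func \<Rightarrow> ('o, 'a, 'p, 'b) func \<Rightarrow> ('o, 'a, 'q, 'c) func" where
  "func_comp G F = \<lparr>onOb = onOb G \<circ> onOb F, onAr = onAr G \<circ> onAr F\<rparr>"

definition faithful :: "('o, 'a) cat \<Rightarrow> ('o, 'a, 'p, 'b) func \<Rightarrow> bool" where
  "faithful C F \<longleftrightarrow> (\<forall>X\<in>Ob C. \<forall>Y\<in>Ob C. inj_on (onAr F) (Hom C X Y))"

definition faithful_embedding ::
    "('o, 'a) cat \<Rightarrow> ('p, 'b) cat \<Rightarrow> ('o, 'a, 'p, 'b) func \<Rightarrow> bool" where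
  "faithful_embedding C D F \<longleftrightarrow> cat_functor C D F \<and> faithful C F \<and> inj_on (onOb F) (Ob C)"

definition prod_cat :: "('o, 'a) cat \<Rightarrow> ('p, 'b) cat \<Rightarrow> ('o \<times> 'p, 'a \<times> 'b) cat" where
  "prod_cat C D = \<lparr>
     Ob = Ob C \<times> Ob D,
     Ar = Ar C \<times> Ar D,
     Dom = map_prod (Dom C) (Dom D),
     Cod = map_prod (Cod C) (Cod D),
     Ide = map_prod (Ide C) (Ide D),
     Cmp = (\<lambda>(g, g') (f, f'). (g \<cdot>\<^bsub>C\<^esub> f, g' \<cdot>\<^bsub>D\<^esub> f'))\<rparr>"

definition monic :: "('o, 'a) cat \<Rightarrow> 'a \<Rightarrow> bool" where
  "monic C m \<longleftrightarrow> m \<in> Ar C \<and>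
     (\<forall>X\<in>Ob C. \<forall>f\<in>Hom C X (Dom C m). \<forall>g\<in>Hom C X (Dom C m). m \<cdot>\<^bsub>C\<^esub> f = m \<cdot>\<^bsub>C\<^esub> g \<longrightarrow> f = g)"

definition is_iso :: "('o, 'a) cat \<Rightarrow> 'a \<Rightarrow> bool" where
  "is_iso C f \<longleftrightarrow> f \<in> Ar C \<and> (\<exists>g\<in>Hom C (Cod C f) (Dom C f).
     g \<cdot>\<^bsub>C\<^esub> f = Ide C (Dom C f) \<and> f \<cdot>\<^bsub>C\<^esub> g = Ide C (Cod C f))"

text \<open>In the next definitions \<open>p\<close> and \<open>q\<close> are the two sides of a commuting square
  \<open>f p = g q\<close>, with \<open>f\<close> and \<open>g\<close> forming the cospan.\<close>

definition commuting_square :: "('o, 'a) cat \<Rightarrow> 'a \<Rightarrow> 'a \<Rightarrow> 'a \<Rightarrow> 'a \<Rightarrow> bool" where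
  "commuting_square C f g p q \<longleftrightarrow> {f, g, p, q} \<subseteq> Ar C \<and> Cod C f = Cod C g \<and> Dom C p = Dom C q \<and>
     Cod C p = Dom C f \<and> Cod C q = Dom C g \<and> f \<cdot>\<^bsub>C\<^esub> p = g \<cdot>\<^bsub>C\<^esub> q"

definition weak_pullback :: "('o, 'a) cat \<Rightarrow> 'a \<Rightarrow> 'a \<Rightarrow> 'a \<Rightarrow> 'a \<Rightarrow> bool" where
  "weak_pullback C f g p q \<longleftrightarrow> commuting_square C f g p q \<and>
     (\<forall>p' q'. commuting_square C f g p' q' \<longrightarrow>
        (\<exists>h\<in>Hom C (Dom C p') (Dom C p). p \<cdot>\<^bsub>C\<^esub> h = p' \<and> q \<cdot>\<^bsub>C\<^esub> h = q'))"

definition pullback :: "('o, 'a) cat \<Rightarrow> 'a \<Rightarrow> 'a \<Rightarrow> 'a \<Rightarrow> 'a \<Rightarrow> bool" where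
  "pullback C f g p q \<longleftrightarrow> commuting_square C f g p q \<and>
     (\<forall>p' q'. commuting_square C f g p' q' \<longrightarrow>
        (\<exists>!h. h \<in> Hom C (Dom C p') (Dom C p) \<and> p \<cdot>\<^bsub>C\<^esub> h = p' \<and> q \<cdot>\<^bsub>C\<^esub> h = q'))"

definition weakly_preserves_pullbacks ::
    "('o, 'a) cat \<Rightarrow> ('p, 'b) cat \<Rightarrow> ('o, 'a, 'p, 'b) func \<Rightarrow> bool" where
  "weakly_preserves_pullbacks C D F \<longleftrightarrow> (\<forall>f g p q. pullback C f g p q \<longrightarrow>
     weak_pullback D (onAr F f) (onAr F g) (onAr F p) (onAr F q))"

definition is_product :: "('o, 'a) cat \<Rightarrow> 'o \<Rightarrow> 'o \<Rightarrow> 'a \<Rightarrow> 'a \<Rightarrow> bool" where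
  "is_product C X Y p q \<longleftrightarrow> p \<in> Hom C (Dom C p) X \<and> q \<in> Hom C (Dom C p) Y \<and>
     (\<forall>Z\<in>Ob C. \<forall>f\<in>Hom C Z X. \<forall>g\<in>Hom C Z Y.
        \<exists>!h. h \<in> Hom C Z (Dom C p) \<and> p \<cdot>\<^bsub>C\<^esub> h = f \<and> q \<cdot>\<^bsub>C\<^esub> h = g)"

text \<open>\<open>P X Y\<close> is the pair of projections of a chosen product of \<open>X\<close> and \<open>Y\<close>; the product
  object itself is their common domain.\<close>

definition binary_products :: "('o, 'a) cat \<Rightarrow> ('o \<Rightarrow> 'o \<Rightarrow> 'a \<times> 'a) \<Rightarrow> bool" where
  "binary_products C P \<longleftrightarrow> (\<forall>X\<in>Ob C. \<forall>Y\<in>Ob C. is_product C X Y (fst (P X Y)) (snd (P X Y)))"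

definition prod_ob :: "('o, 'a) cat \<Rightarrow> ('o \<Rightarrow> 'o \<Rightarrow> 'a \<times> 'a) \<Rightarrow> 'o \<Rightarrow> 'o \<Rightarrow> 'o" where
  "prod_ob C P X Y = Dom C (fst (P X Y))"

definition prod_ar :: "('o, 'a) cat \<Rightarrow> ('o \<Rightarrow> 'o \<Rightarrow> 'a \<times> 'a) \<Rightarrow> 'a \<Rightarrow> 'a \<Rightarrow> 'a" where
  "prod_ar C P f g =
    (let X = Dom C f; X' = Cod C f; Y = Dom C g; Y' = Cod C g in
     THE h. h \<in> Hom C (prod_ob C P X Y) (prod_ob C P X' Y') \<and>
       fst (P X' Y') \<cdot>\<^bsub>C\<^esub> h = f \<cdot>\<^bsub>C\<^esub> fst (P X Y) \<and>
       snd (P X' Y') \<cdot>\<^bsub>C\<^esub> h = g \<cdot>\<^bsub>C\<^esub> snd (P X Y))"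

definition cocone ::
    "('i, 'j) cat \<Rightarrow> ('o, 'a) cat \<Rightarrow> ('i, 'j, 'o, 'a) func \<Rightarrow> 'o \<Rightarrow> ('i \<Rightarrow> 'a) \<Rightarrow> bool" where
  "cocone J C D c l \<longleftrightarrow> c \<in> Ob C \<and> (\<forall>i\<in>Ob J. l i \<in> Hom C (onOb D i) c) \<and>
     (\<forall>u\<in>Ar J. l (Cod J u) \<cdot>\<^bsub>C\<^esub> onAr D u = l (Dom J u))"

definition colimit ::
    "('i, 'j) cat \<Rightarrow> ('o, 'a) cat \<Rightarrow> ('i, 'j, 'o, 'a) func \<Rightarrow> 'o \<Rightarrow> ('i \<Rightarrow> 'a) \<Rightarrow> bool" where
  "colimit J C D c l \<longleftrightarrow> cocone J C D c l \<and>
     (\<forall>c' l'. cocone J C D c' l' \<longrightarrow>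
        (\<exists>!h. h \<in> Hom C c c' \<and> (\<forall>i\<in>Ob J. h \<cdot>\<^bsub>C\<^esub> l i = l' i)))"

section \<open>The category of sets and coalgebras\<close>

text \<open>
  The role of the class of all sets is played by the small subsets of a type \<open>'u\<close>, where small
  means of cardinality less than that of \<open>'u\<close>. If the cardinality of \<open>'u\<close> is
  strongly inaccessible, the small sets form, up to equivalence of categories, the sets of a
  Grothendieck universe. Uncountability is not required, so that countable \<open>'u\<close>, for which
  the small sets are the finite ones, is covered as well.
\<close>

definition small :: "'u set \<Rightarrow> bool" where
  "small A \<longleftrightarrow> |A| <o |UNIV :: 'u set|"

definition universe :: "'u itself \<Rightarrow> bool" where
  "universe (_ :: 'u itself) \<longleftrightarrow> infinite (UNIV :: 'u set) \<and> regularCard |UNIV :: 'u set| \<and>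
     (\<forall>A :: 'u set. small A \<longrightarrow> |Pow A| <o |UNIV :: 'u set| )"

datatype ('o, 'f) arrow = Arrow (src: 'o) (under: 'f) (tgt: 'o)

type_synonym 'u smap = "('u set, 'u \<Rightarrow> 'u) arrow"

definition set_cat :: "('u set, 'u smap) cat" where
  "set_cat = \<lparr>
     Ob = {A. small A},
     Ar = {Arrow A f B | A f B. small A \<and> small B \<and> f \<in> A \<rightarrow>\<^sub>E B},
     Dom = src,
     Cod = tgt,
     Ide = (\<lambda>A. Arrow A (\<lambda>x\<in>A. x) A),
     Cmp = (\<lambda>g f. Arrow (src f) (compose (src f) (under g) (under f)) (tgt g))\<rparr>"

type_synonym 'u set_endo = "('u set, 'u smap, 'u set, 'u smap) func"

definition coalg_cat ::
    "('o, 'a) cat \<Rightarrow> ('o, 'a, 'o, 'a) func \<Rightarrow> ('o \<times> 'a, ('o \<times> 'a, 'a) arrow) cat" where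
  "coalg_cat C F =
    (let Coalg = {(A, \<alpha>). A \<in> Ob C \<and> \<alpha> \<in> Hom C A (onOb F A)} in \<lparr>
     Ob = Coalg,
     Ar = {Arrow (A, \<alpha>) \<phi> (B, \<beta>) | A \<alpha> \<phi> B \<beta>. (A, \<alpha>) \<in> Coalg \<and> (B, \<beta>) \<in> Coalg \<and>
       \<phi> \<in> Hom C A B \<and> \<beta> \<cdot>\<^bsub>C\<^esub> \<phi> = onAr F \<phi> \<cdot>\<^bsub>C\<^esub> \<alpha>},
     Dom = src,
     Cod = tgt,
     Ide = (\<lambda>X. Arrow X (Ide C (fst X)) X),
     Cmp = (\<lambda>g f. Arrow (src f) (under g \<cdot>\<^bsub>C\<^esub> under f) (tgt g))\<rparr>)"

abbreviation Set_coalg ::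
    "'u set_endo \<Rightarrow> ('u set \<times> 'u smap, ('u set \<times> 'u smap, 'u smap) arrow) cat" where
  "Set_coalg F \<equiv> coalg_cat set_cat F"

definition nontrivial :: "'u set_endo \<Rightarrow> bool" where
  "nontrivial F \<longleftrightarrow> (\<forall>X. small X \<longrightarrow> onOb F X = {} \<longrightarrow> X = {})"

definition subcoalgebra :: "'u set_endo \<Rightarrow> 'u set \<times> 'u smap \<Rightarrow> 'u set \<Rightarrow> bool" where
  "subcoalgebra F X S \<longleftrightarrow> S \<subseteq> fst X \<and>
     (\<exists>\<sigma>. Arrow (S, \<sigma>) (Arrow S (\<lambda>x\<in>S. x) (fst X)) X \<in> Ar (Set_coalg F))"

text \<open>Cardinals are the cardinalities \<open>|K|\<close> of small sets \<open>K\<close>.\<close>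

definition bounded :: "'u set_endo \<Rightarrow> bool" where
  "bounded F \<longleftrightarrow> (\<exists>K :: 'u set. small K \<and> (\<forall>X\<in>Ob (Set_coalg F). \<forall>x\<in>fst X.
     \<exists>S. subcoalgebra F X S \<and> x \<in> S \<and> |S| \<le>o |K| ))"

text \<open>Every small category is isomorphic to one whose objects and arrows are elements of \<open>'u\<close>,
  so index categories are taken in this form.\<close>

definition small_cat :: "('u, 'u) cat \<Rightarrow> bool" where
  "small_cat J \<longleftrightarrow> category J \<and> small (Ob J) \<and> small (Ar J)"

definition filtered :: "'u set \<Rightarrow> ('u, 'u) cat \<Rightarrow> bool" where
  "filtered K J \<longleftrightarrow> category J \<and>
     (\<forall>(I :: ('u, 'u) cat) E. |Ar I| <o |K| \<longrightarrow> cat_functor I J E \<longrightarrow> (\<exists>c l. cocone I J E c l))"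

definition accessible :: "'u set_endo \<Rightarrow> bool" where
  "accessible F \<longleftrightarrow> (\<exists>K :: 'u set. small K \<and> infinite K \<and> regularCard |K| \<and>
     (\<forall>(J :: ('u, 'u) cat) D c l. small_cat J \<longrightarrow> filtered K J \<longrightarrow> cat_functor J set_cat D \<longrightarrow>
        colimit J set_cat D c l \<longrightarrow>
        colimit J set_cat (func_comp F D) (onOb F c) (onAr F \<circ> l)))"

section \<open>Partial morphisms\<close>

definition spans :: "('o, 'a) cat \<Rightarrow> ('a \<times> 'a) set" where
  "spans C = {(m, \<phi>). monic C m \<and> \<phi> \<in> Ar C \<and> Dom C m = Dom C \<phi>}"

definition span_equiv :: "('o, 'a) cat \<Rightarrow> (('a \<times> 'a) \<times> ('a \<times> 'a)) set" where
  "span_equiv C = {((m, \<phi>), (m', \<phi>')). (m, \<phi>) \<in> spans C \<and> (m', \<phi>') \<in> spans C \<and>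
     (\<exists>\<theta>\<in>Hom C (Dom C m) (Dom C m'). is_iso C \<theta> \<and> m = m' \<cdot>\<^bsub>C\<^esub> \<theta> \<and> \<phi> = \<phi>' \<cdot>\<^bsub>C\<^esub> \<theta>)}"

text \<open>The partial morphism \<open>{m, \<phi>}\<close>, together with its domain and codomain.\<close>

definition pfn_class :: "('o, 'a) cat \<Rightarrow> 'a \<Rightarrow> 'a \<Rightarrow> ('o, ('a \<times> 'a) set) arrow" where
  "pfn_class C m \<phi> = Arrow (Cod C m) (span_equiv C `` {(m, \<phi>)}) (Cod C \<phi>)"

text \<open>A composite is the class \<open>{m q, \<phi>' r}\<close> obtained from any choice of representatives and of
  a pullback.\<close>

definition pfn_comp ::
    "('o, 'a) cat \<Rightarrow> ('o, ('a \<times> 'a) set) arrow \<Rightarrow> ('o, ('a \<times> 'a) set) arrow \<Rightarrow>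
     ('o, ('a \<times> 'a) set) arrow" where
  "pfn_comp C g f = (THE h. \<exists>m \<phi> m' \<phi>' q r.
     (m, \<phi>) \<in> spans C \<and> f = pfn_class C m \<phi> \<and>
     (m', \<phi>') \<in> spans C \<and> g = pfn_class C m' \<phi>' \<and>
     pullback C \<phi> m' q r \<and> h = pfn_class C (m \<cdot>\<^bsub>C\<^esub> q) (\<phi>' \<cdot>\<^bsub>C\<^esub> r))"

definition pfn_cat :: "('o, 'a) cat \<Rightarrow> ('o, ('o, ('a \<times> 'a) set) arrow) cat" where
  "pfn_cat C = \<lparr>
     Ob = Ob C,
     Ar = {pfn_class C m \<phi> | m \<phi>. (m, \<phi>) \<in> spans C},
     Dom = src,
     Cod = tgt,
     Ide = (\<lambda>X. pfn_class C (Ide C X) (Ide C X)),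
     Cmp = pfn_comp C\<rparr>"

end

theory Submission
  imports Defs
begin

text \<open>
  A partial morphism is determined by its graph, the relation on arrows with a common domain
  \<open>{(m z, \<phi> z) | z}\<close>. This is the image of a span under the Yoneda embedding: a span is
  recovered from it up to isomorphism because \<open>m\<close> is monic (\<open>span_equiv_iff_graph\<close>). Pulling
  back turns composition of partial morphisms into composition of relations
  (\<open>span_graph_composite\<close>), so that well-definedness, associativity and the unit laws of the
  category of partial morphisms reduce to facts about relations. The product of two partial morphisms
  relates \<open>a\<close> to \<open>c\<close> iff both components of \<open>a\<close> and \<open>c\<close> are related
  (\<open>span_graph_prod\<close>), and this description makes it independent of the representatives and
  functorial. A total morphism \<open>\<phi>\<close> has the graph \<open>{(z, \<phi> z) | z}\<close>, from which \<open>\<phi>\<close> is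
  read off at the identity; hence faithfulness. All of this works in any category that has pullbacks
  of monomorphisms and binary products.

  It remains to find these limits among coalgebras. As \<open>F\<close> weakly preserves pullbacks, the
  pullback of the underlying maps carries a coalgebra structure (\<open>hom_pullback_ex\<close>). Applied to a
  kernel pair, this shows that monomorphisms are injective (\<open>monic_inj\<close>). Since \<open>F\<close> preserves
  injectivity (\<open>Fm_inj\<close>), the pullback of a monomorphism computed on the underlying sets is a
  pullback of coalgebras (\<open>monic_pullback\<close>).

  Products are quotients by bisimilarity. The elements of a coalgebra \<open>Z\<close> with morphisms to
  \<open>X\<close> and \<open>Y\<close> are coloured by their pairs of images. If \<open>F\<close> is
  bounded by the cardinality of \<open>K\<close>, let \<open>W\<close> be the coproduct of all coalgebras on subsets of \<open>K\<close>
  with morphisms to \<open>X\<close> and \<open>Y\<close>. Then every element of every such \<open>Z\<close> is bisimilar to an element of \<open>W\<close>, and bisimilarity is an equivalence because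
  spans of coalgebras can be composed by pullback. Sending each element of \<open>Z\<close> to its
  bisimilarity class in \<open>W\<close> is then the only morphism from \<open>Z\<close> to the quotient
  of \<open>W\<close> that respects colours (\<open>bisim_quotient_terminal\<close>, \<open>bisim_quotient_separated\<close>): the
  quotient is the product (\<open>product_ex\<close>).

  Finally, an accessible functor is bounded (\<open>accessible_imp_bounded\<close>). A set is the
  \<open>\<kappa>\<close>-filtered union of its subsets of size less than \<open>\<kappa>\<close>, so each \<open>\<alpha> x\<close> already comes from
  such a subset (\<open>accessible_support\<close>). Closing \<open>{x}\<close> under these supports takes countably many
  steps and yields a subcoalgebra of size at most \<open>\<kappa>\<close>.
\<close>

section \<open>Partial morphisms as relations\<close>

lemma Hom_I: "f \<in> Ar C \<Longrightarrow> Dom C f = X \<Longrightarrow> Cod C f = Y \<Longrightarrow> f \<in> Hom C X Y"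
  by (simp add: Hom_def)

lemma Hom_D: "f \<in> Hom C X Y \<Longrightarrow> f \<in> Ar C \<and> Dom C f = X \<and> Cod C f = Y"
  by (simp add: Hom_def)

text \<open>
  The relation that a span induces on generalized elements, that is, on arrows into its two ends.
\<close>

definition span_graph :: "('o, 'a) cat \<Rightarrow> 'a \<Rightarrow> 'a \<Rightarrow> ('a \<times> 'a) set" where
  "span_graph C m \<phi> = {(Cmp C m z, Cmp C \<phi> z) | z. z \<in> Ar C \<and> Cod C z = Dom C m}"

definition pfn_graph :: "('o, 'a) cat \<Rightarrow> ('o, ('a \<times> 'a) set) arrow \<Rightarrow> ('a \<times> 'a) set" where
  "pfn_graph C f = (\<Union>(m, \<phi>)\<in>under f. span_graph C m \<phi>)"

context category
begin

lemma Cmp_Ar [simp]: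
  assumes "f \<in> Ar C" "g \<in> Ar C" "Cod C f = Dom C g"
  shows "g \<cdot> f \<in> Ar C" "Dom C (g \<cdot> f) = Dom C f" "Cod C (g \<cdot> f) = Cod C g"
  using Cmp_in[of f "Dom C f" "Cod C f" g "Cod C g"] assms by (auto simp: Hom_def)

lemma Ide_Ar [simp]:
  assumes "X \<in> Ob C"
  shows "Ide C X \<in> Ar C" "Dom C (Ide C X) = X" "Cod C (Ide C X) = X"
  using Ide_in[OF assms] by (auto simp: Hom_def)

lemma Cmp_Ide_Dom [simp]: "f \<in> Ar C \<Longrightarrow> Dom C f = X \<Longrightarrow> f \<cdot> Ide C X = f"
  using Cmp_Ide[of f "Dom C f" "Cod C f"] by (auto simp: Hom_def)

lemma Ide_Cod_Cmp [simp]: "f \<in> Ar C \<Longrightarrow> Cod C f = X \<Longrightarrow> Ide C X \<cdot> f = f"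
  using Ide_Cmp[of f "Dom C f" "Cod C f"] by (auto simp: Hom_def)

lemma assoc:
  "f \<in> Ar C \<Longrightarrow> g \<in> Ar C \<Longrightarrow> h \<in> Ar C \<Longrightarrow> Cod C f = Dom C g \<Longrightarrow> Cod C g = Dom C h \<Longrightarrow>
    (h \<cdot> g) \<cdot> f = h \<cdot> (g \<cdot> f)"
  using Cmp_assoc[of f "Dom C f" "Cod C f" g "Cod C g" h "Cod C h"] by (auto simp: Hom_def)

lemma monicD:
  "monic C m \<Longrightarrow> f \<in> Ar C \<Longrightarrow> g \<in> Ar C \<Longrightarrow> Cod C f = Dom C m \<Longrightarrow> Cod C g = Dom C m \<Longrightarrow>
    Dom C f = Dom C g \<Longrightarrow> m \<cdot> f = m \<cdot> g \<Longrightarrow> f = g"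
  unfolding monic_def by (metis (mono_tags, lifting) Dom_in Hom_I)

lemma monicI:
  assumes "m \<in> Ar C"
    and "\<And>f g. \<lbrakk>f \<in> Ar C; g \<in> Ar C; Cod C f = Dom C m; Cod C g = Dom C m; Dom C f = Dom C g;
      m \<cdot> f = m \<cdot> g\<rbrakk> \<Longrightarrow> f = g"
  shows "monic C m"
  unfolding monic_def using assms by (metis (no_types, lifting) Hom_D)

lemma monic_Ar [simp]: "monic C m \<Longrightarrow> m \<in> Ar C"
  by (simp add: monic_def)

lemma monic_Ide [simp]: "X \<in> Ob C \<Longrightarrow> monic C (Ide C X)"
  by (rule monicI) auto

lemma monic_Cmp: "monic C m \<Longrightarrow> monic C n \<Longrightarrow> Cod C m = Dom C n \<Longrightarrow> monic C (n \<cdot> m)"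
proof (rule monicI)
  fix f g assume mn: "monic C m" "monic C n" "Cod C m = Dom C n"
    and fg: "f \<in> Ar C" "g \<in> Ar C" "Cod C f = Dom C (n \<cdot> m)" "Cod C g = Dom C (n \<cdot> m)"
      "Dom C f = Dom C g" and e: "(n \<cdot> m) \<cdot> f = (n \<cdot> m) \<cdot> g"
  have "n \<cdot> (m \<cdot> f) = n \<cdot> (m \<cdot> g)"
    using mn fg e by (simp add: assoc)
  then have "m \<cdot> f = m \<cdot> g"
    using mn fg by - (rule monicD[OF mn(2)], auto)
  then show "f = g"
    using mn fg by - (rule monicD[OF mn(1)], auto)
qed auto

lemma pullback_monic:
  assumes pb: "pullback C f m q r" and m: "monic C m"
  shows "monic C q"
proof (rule monicI)
  have sq: "commuting_square C f m q r"
    using pb by (simp add: pullback_def)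
  then show "q \<in> Ar C"
    by (simp add: commuting_square_def)
  note s = sq[unfolded commuting_square_def]
  fix x y assume x: "x \<in> Ar C" "Cod C x = Dom C q" and y: "y \<in> Ar C" "Cod C y = Dom C q"
    and d: "Dom C x = Dom C y" and e: "q \<cdot> x = q \<cdot> y"
  have "m \<cdot> (r \<cdot> x) = f \<cdot> (q \<cdot> x)"
    using s x by (simp flip: assoc)
  moreover have "m \<cdot> (r \<cdot> y) = f \<cdot> (q \<cdot> y)"
    using s y by (simp flip: assoc)
  ultimately have r: "r \<cdot> x = r \<cdot> y"
    using s x y d e by - (rule monicD[OF m], auto)
  have "commuting_square C f m (q \<cdot> x) (r \<cdot> x)"
    using s x by (auto simp: commuting_square_def simp flip: assoc)
  then have "\<exists>!h. h \<in> Hom C (Dom C (q \<cdot> x)) (Dom C q) \<and> q \<cdot> h = q \<cdot> x \<and> r \<cdot> h = r \<cdot> x"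
    using pb by (simp add: pullback_def)
  moreover have "x \<in> Hom C (Dom C (q \<cdot> x)) (Dom C q)" "y \<in> Hom C (Dom C (q \<cdot> x)) (Dom C q)"
    using s x y d by (auto simp: Hom_def)
  ultimately show "x = y"
    using e r by metis
qed

lemma spansD:
  assumes "(m, \<phi>) \<in> spans C"
  shows "monic C m" "m \<in> Ar C" "\<phi> \<in> Ar C" "Dom C \<phi> = Dom C m"
  using assms by (auto simp: spans_def)

lemma span_graph_self:
  assumes "(m, \<phi>) \<in> spans C"
  shows "(m, \<phi>) \<in> span_graph C m \<phi>"
proof -
  note s = spansD[OF assms]
  then have "(m \<cdot> Ide C (Dom C m), \<phi> \<cdot> Ide C (Dom C m)) \<in> span_graph C m \<phi>"
    unfolding span_graph_def by (auto simp: Dom_in intro!: exI[of _ "Ide C (Dom C m)"])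
  then show ?thesis
    using s by simp
qed

text \<open>
  The graph of a span is closed under precomposition, so it contains the graph of every span that
  belongs to it as a pair. This is the Yoneda lemma for spans.
\<close>

lemma span_graph_subset:
  assumes "(m, \<phi>) \<in> spans C" "(n, \<psi>) \<in> spans C" "(m, \<phi>) \<in> span_graph C n \<psi>"
  shows "span_graph C m \<phi> \<subseteq> span_graph C n \<psi>"
proof
  note m = spansD[OF assms(1)] and n = spansD[OF assms(2)]
  fix w assume "w \<in> span_graph C m \<phi>"
  then obtain z where z: "w = (m \<cdot> z, \<phi> \<cdot> z)" "z \<in> Ar C" "Cod C z = Dom C m"
    by (auto simp: span_graph_def)
  obtain t where t: "m = n \<cdot> t" "\<phi> = \<psi> \<cdot> t" "t \<in> Ar C" "Cod C t = Dom C n"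
    using assms(3) by (auto simp: span_graph_def)
  have dt: "Dom C m = Dom C t"
    using t n by simp
  have "w = (n \<cdot> (t \<cdot> z), \<psi> \<cdot> (t \<cdot> z))"
    using z t n dt by (simp add: assoc)
  then show "w \<in> span_graph C n \<psi>"
    using z t dt by (auto simp: span_graph_def intro!: exI[of _ "t \<cdot> z"])
qed

text \<open>
  Equal graphs give factorizations of each span through the other. As the left legs are monic, these
  factorizations are inverse to each other.
\<close>

lemma span_equiv_iff_graph:
  assumes s: "(m, \<phi>) \<in> spans C" and s': "(n, \<psi>) \<in> spans C"
  shows "((m, \<phi>), (n, \<psi>)) \<in> span_equiv C \<longleftrightarrow> span_graph C m \<phi> = span_graph C n \<psi>"
proof
  note m = spansD[OF s] and n = spansD[OF s']
  assume "((m, \<phi>), (n, \<psi>)) \<in> span_equiv C"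
  then obtain t where t: "t \<in> Hom C (Dom C m) (Dom C n)" "is_iso C t" "m = n \<cdot> t" "\<phi> = \<psi> \<cdot> t"
    by (auto simp: span_equiv_def)
  then obtain u where u: "u \<in> Hom C (Dom C n) (Dom C m)" "t \<cdot> u = Ide C (Dom C n)"
    unfolding is_iso_def by (auto simp: Hom_def)
  have "m \<cdot> u = n \<cdot> (t \<cdot> u)" "\<phi> \<cdot> u = \<psi> \<cdot> (t \<cdot> u)"
    unfolding t(3,4) by (rule assoc; use t(1) u(1) n in \<open>simp add: Hom_def\<close>)+
  then have "n = m \<cdot> u" "\<psi> = \<phi> \<cdot> u"
    using n by (simp_all add: u(2))
  then have "(n, \<psi>) \<in> span_graph C m \<phi>"
    using u by (auto simp: span_graph_def Hom_def)
  moreover have "(m, \<phi>) \<in> span_graph C n \<psi>"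
    using t by (auto simp: span_graph_def Hom_def)
  ultimately show "span_graph C m \<phi> = span_graph C n \<psi>"
    using span_graph_subset s s' by blast
next
  note m = spansD[OF s] and n = spansD[OF s']
  assume eq: "span_graph C m \<phi> = span_graph C n \<psi>"
  then obtain t where t: "m = n \<cdot> t" "\<phi> = \<psi> \<cdot> t" "t \<in> Ar C" "Cod C t = Dom C n"
    using span_graph_self[OF s] by (auto simp: span_graph_def)
  obtain u where u: "n = m \<cdot> u" "u \<in> Ar C" "Cod C u = Dom C m"
    using eq span_graph_self[OF s'] by (force simp: span_graph_def)
  have dt: "Dom C t = Dom C m"
    using t n by simp
  have du: "Dom C u = Dom C n"
    using u m by simp
  have "n \<cdot> (t \<cdot> u) = n \<cdot> Ide C (Dom C n)"
    using t u n dt du by (metis Cmp_Ide_Dom assoc)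
  then have 1: "t \<cdot> u = Ide C (Dom C n)"
    using t(3,4) u(2,3) n dt du Dom_in by - (rule monicD[OF n(1)], auto)
  have "m \<cdot> (u \<cdot> t) = m \<cdot> Ide C (Dom C m)"
    using t u m dt du by (metis Cmp_Ide_Dom assoc)
  then have 2: "u \<cdot> t = Ide C (Dom C m)"
    using t(3,4) u(2,3) m dt du Dom_in by - (rule monicD[OF m(1)], auto)
  have "is_iso C t"
    unfolding is_iso_def using t u dt du 1 2 by (auto simp: Hom_def)
  then show "((m, \<phi>), (n, \<psi>)) \<in> span_equiv C"
    unfolding span_equiv_def using s s' t dt by (auto simp: Hom_def)
qed

lemma pfn_graph_class [simp]:
  assumes s: "(m, \<phi>) \<in> spans C"
  shows "pfn_graph C (pfn_class C m \<phi>) = span_graph C m \<phi>"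
proof -
  have eq: "span_graph C n \<psi> = span_graph C m \<phi>" if "((m, \<phi>), (n, \<psi>)) \<in> span_equiv C" for n \<psi>
    using that span_equiv_iff_graph[OF s] by (auto simp: span_equiv_def)
  have refl: "(m, \<phi>) \<in> under (pfn_class C m \<phi>)"
    using span_equiv_iff_graph[OF s s] by (simp add: pfn_class_def)
  show ?thesis
  proof (intro equalityI subsetI)
    fix w assume "w \<in> pfn_graph C (pfn_class C m \<phi>)"
    then obtain n \<psi> where "((m, \<phi>), (n, \<psi>)) \<in> span_equiv C" "w \<in> span_graph C n \<psi>"
      by (auto simp: pfn_graph_def pfn_class_def)
    then show "w \<in> span_graph C m \<phi>"
      using eq by blast
  next
    fix w assume "w \<in> span_graph C m \<phi>"
    then show "w \<in> pfn_graph C (pfn_class C m \<phi>)"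
      unfolding pfn_graph_def using refl by (intro UN_I[OF refl]) simp
  qed
qed

lemma pfn_class_eqI:
  assumes s: "(m, \<phi>) \<in> spans C" and s': "(n, \<psi>) \<in> spans C"
    and eq: "span_graph C m \<phi> = span_graph C n \<psi>"
  shows "pfn_class C m \<phi> = pfn_class C n \<psi>"
proof -
  have "((m, \<phi>), (a, b)) \<in> span_equiv C \<longleftrightarrow> ((n, \<psi>), (a, b)) \<in> span_equiv C" for a b
  proof (cases "(a, b) \<in> spans C")
    case True
    then show ?thesis
      using span_equiv_iff_graph[OF s] span_equiv_iff_graph[OF s'] eq by simp
  qed (simp add: span_equiv_def)
  then have "span_equiv C `` {(m, \<phi>)} = span_equiv C `` {(n, \<psi>)}"
    by auto
  moreover obtain t where "m = n \<cdot> t" "\<phi> = \<psi> \<cdot> t" "t \<in> Ar C" "Cod C t = Dom C n"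
    using eq span_graph_self[OF s] by (auto simp: span_graph_def)
  ultimately show ?thesis
    using spansD[OF s'] by (simp add: pfn_class_def)
qed

lemma pfn_class_in: "(m, \<phi>) \<in> spans C \<Longrightarrow> pfn_class C m \<phi> \<in> Hom (pfn_cat C) (Cod C m) (Cod C \<phi>)"
  by (auto simp: Hom_def pfn_cat_def pfn_class_def)

lemma pfn_HomE:
  assumes "f \<in> Hom (pfn_cat C) X Y"
  obtains m \<phi> where "(m, \<phi>) \<in> spans C" "f = pfn_class C m \<phi>" "Cod C m = X" "Cod C \<phi> = Y"
  using assms by (auto simp: Hom_def pfn_cat_def pfn_class_def)

lemma pfn_eqI:
  assumes "f \<in> Hom (pfn_cat C) X Y" "g \<in> Hom (pfn_cat C) X' Y'" "pfn_graph C f = pfn_graph C g"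
  shows "f = g"
  using assms by (auto elim!: pfn_HomE intro: pfn_class_eqI)

lemma pfn_graph_Ar:
  assumes "f \<in> Hom (pfn_cat C) X Y" "(a, b) \<in> pfn_graph C f"
  shows "a \<in> Ar C" "b \<in> Ar C" "Dom C a = Dom C b" "Cod C a = X" "Cod C b = Y"
proof -
  obtain m \<phi> where s: "(m, \<phi>) \<in> spans C" "f = pfn_class C m \<phi>" "Cod C m = X" "Cod C \<phi> = Y"
    using assms(1) by (rule pfn_HomE)
  then have "(a, b) \<in> span_graph C m \<phi>"
    using assms(2) by simp
  then show "a \<in> Ar C" "b \<in> Ar C" "Dom C a = Dom C b" "Cod C a = X" "Cod C b = Y"
    using s spansD[OF s(1)] by (auto simp: span_graph_def)
qed

lemma Ide_span: "\<phi> \<in> Ar C \<Longrightarrow> Dom C \<phi> = X \<Longrightarrow> (Ide C X, \<phi>) \<in> spans C"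
  using Dom_in by (auto simp: spans_def)

lemma pfn_graph_total:
  assumes "\<phi> \<in> Ar C" "Dom C \<phi> = X"
  shows "pfn_graph C (pfn_class C (Ide C X) \<phi>) = {(z, \<phi> \<cdot> z) | z. z \<in> Ar C \<and> Cod C z = X}"
  using assms Dom_in[of \<phi>] by (force simp: Ide_span span_graph_def)

lemma pfn_Ide: "Ide (pfn_cat C) X = pfn_class C (Ide C X) (Ide C X)"
  by (simp add: pfn_cat_def)

lemma pfn_graph_Ide:
  assumes "X \<in> Ob C"
  shows "pfn_graph C (Ide (pfn_cat C) X) = {(z, z) | z. z \<in> Ar C \<and> Cod C z = X}"
  using pfn_graph_total[of "Ide C X" X] assms by (auto simp: pfn_cat_def)

lemma pfn_Ide_in: "X \<in> Ob C \<Longrightarrow> Ide (pfn_cat C) X \<in> Hom (pfn_cat C) X X"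
  using pfn_class_in[OF Ide_span, of "Ide C X" X] by (simp add: pfn_cat_def)

text \<open>
  A generalized element of the pullback is a pair of generalized elements of the two apexes which
  agree in the middle object. That is the witness required by the relational composite.
\<close>

lemma span_graph_composite:
  assumes s: "(m, \<phi>) \<in> spans C" and s': "(m', \<phi>') \<in> spans C" and pb: "pullback C \<phi> m' q r"
  shows "(m \<cdot> q, \<phi>' \<cdot> r) \<in> spans C"
    and "span_graph C (m \<cdot> q) (\<phi>' \<cdot> r) = span_graph C m \<phi> O span_graph C m' \<phi>'"
proof -
  note m = spansD[OF s] and m' = spansD[OF s']
  have sq: "q \<in> Ar C" "r \<in> Ar C" "Cod C \<phi> = Cod C m'" "Dom C q = Dom C r"
    "Cod C q = Dom C \<phi>" "Cod C r = Dom C m'" "\<phi> \<cdot> q = m' \<cdot> r"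
    using pb by (auto simp: pullback_def commuting_square_def)
  show "(m \<cdot> q, \<phi>' \<cdot> r) \<in> spans C"
    using m m' sq monic_Cmp[OF pullback_monic[OF pb m'(1)] m(1)] by (auto simp: spans_def)
  show "span_graph C (m \<cdot> q) (\<phi>' \<cdot> r) = span_graph C m \<phi> O span_graph C m' \<phi>'"
  proof (intro equalityI subsetI)
    fix w assume "w \<in> span_graph C (m \<cdot> q) (\<phi>' \<cdot> r)"
    then obtain z where z: "z \<in> Ar C" "Cod C z = Dom C q" "w = ((m \<cdot> q) \<cdot> z, (\<phi>' \<cdot> r) \<cdot> z)"
      using m sq by (auto simp: span_graph_def)
    have w: "w = (m \<cdot> (q \<cdot> z), \<phi>' \<cdot> (r \<cdot> z))"
      using z m m' sq by (simp add: assoc)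
    have mid: "\<phi> \<cdot> (q \<cdot> z) = m' \<cdot> (r \<cdot> z)"
      using z m m' sq by (simp flip: assoc)
    have "(m \<cdot> (q \<cdot> z), \<phi> \<cdot> (q \<cdot> z)) \<in> span_graph C m \<phi>"
      using z m sq by (auto simp: span_graph_def)
    moreover have "(m' \<cdot> (r \<cdot> z), \<phi>' \<cdot> (r \<cdot> z)) \<in> span_graph C m' \<phi>'"
      using z m' sq by (auto simp: span_graph_def)
    ultimately show "w \<in> span_graph C m \<phi> O span_graph C m' \<phi>'"
      unfolding w mid by blast
  next
    fix w assume "w \<in> span_graph C m \<phi> O span_graph C m' \<phi>'"
    then obtain z z' where z: "z \<in> Ar C" "Cod C z = Dom C m" "z' \<in> Ar C" "Cod C z' = Dom C m'"
      "\<phi> \<cdot> z = m' \<cdot> z'" and w: "w = (m \<cdot> z, \<phi>' \<cdot> z')"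
      by (auto simp: span_graph_def)
    have d: "Dom C z = Dom C z'"
      using z m m' by (metis Cmp_Ar(2))
    have "commuting_square C \<phi> m' z z'"
      using z m m' sq d by (auto simp: commuting_square_def)
    then obtain h where h: "h \<in> Hom C (Dom C z) (Dom C q)" "q \<cdot> h = z" "r \<cdot> h = z'"
      using pb unfolding pullback_def by blast
    have "w = ((m \<cdot> q) \<cdot> h, (\<phi>' \<cdot> r) \<cdot> h)"
      using h w m m' sq by (simp add: assoc Hom_def)
    then show "w \<in> span_graph C (m \<cdot> q) (\<phi>' \<cdot> r)"
      using h m sq by (auto simp: span_graph_def Hom_def)
  qed
qed

end

section \<open>The category of partial morphisms\<close>

locale category_with_monic_pullbacks = category +
  assumes monic_pullback_ex:
    "f \<in> Ar C \<Longrightarrow> monic C m \<Longrightarrow> Cod C f = Cod C m \<Longrightarrow> \<exists>q r. pullback C f m q r"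
begin

text \<open>
  The composite does not depend on the representatives or on the pullback, since its graph is the
  composite of the two graphs.
\<close>

lemma pfn_comp:
  assumes f: "f \<in> Hom (pfn_cat C) X Y" and g: "g \<in> Hom (pfn_cat C) Y Z"
  shows "pfn_comp C g f \<in> Hom (pfn_cat C) X Z"
    and "pfn_graph C (pfn_comp C g f) = pfn_graph C f O pfn_graph C g"
proof -
  obtain m \<phi> where s: "(m, \<phi>) \<in> spans C" "f = pfn_class C m \<phi>" "Cod C m = X" "Cod C \<phi> = Y"
    using f by (rule pfn_HomE)
  obtain m' \<phi>' where s': "(m', \<phi>') \<in> spans C" "g = pfn_class C m' \<phi>'" "Cod C m' = Y" "Cod C \<phi>' = Z"
    using g by (rule pfn_HomE)
  obtain q r where pb: "pullback C \<phi> m' q r"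
    using monic_pullback_ex[of \<phi> m'] s s' spansD[OF s(1)] spansD[OF s'(1)] by auto
  let ?h = "pfn_class C (m \<cdot> q) (\<phi>' \<cdot> r)"
  note c = span_graph_composite[OF s(1) s'(1) pb]
  have "pfn_comp C g f = ?h"
    unfolding pfn_comp_def
  proof (rule the_equality)
    show "\<exists>m \<phi> m' \<phi>' q r. (m, \<phi>) \<in> spans C \<and> f = pfn_class C m \<phi> \<and>
      (m', \<phi>') \<in> spans C \<and> g = pfn_class C m' \<phi>' \<and>
      pullback C \<phi> m' q r \<and> ?h = pfn_class C (m \<cdot> q) (\<phi>' \<cdot> r)"
      using s s' pb by blast
  next
    fix h assume "\<exists>m \<phi> m' \<phi>' q r. (m, \<phi>) \<in> spans C \<and> f = pfn_class C m \<phi> \<and>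
      (m', \<phi>') \<in> spans C \<and> g = pfn_class C m' \<phi>' \<and>
      pullback C \<phi> m' q r \<and> h = pfn_class C (m \<cdot> q) (\<phi>' \<cdot> r)"
    then obtain n \<psi> n' \<psi>' q' r' where t: "(n, \<psi>) \<in> spans C" "f = pfn_class C n \<psi>"
      "(n', \<psi>') \<in> spans C" "g = pfn_class C n' \<psi>'"
      "pullback C \<psi> n' q' r'" and h: "h = pfn_class C (n \<cdot> q') (\<psi>' \<cdot> r')"
      by blast
    note d = span_graph_composite[OF t(1,3,5)]
    have "span_graph C n \<psi> = span_graph C m \<phi>" "span_graph C n' \<psi>' = span_graph C m' \<phi>'"
      using s s' t pfn_graph_class by metis+
    then show "h = ?h"
      unfolding h using c d by (intro pfn_class_eqI) auto
  qed
  moreover have "q \<in> Ar C" "r \<in> Ar C" "Cod C q = Dom C m" "Cod C r = Dom C m'"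
    using pb spansD[OF s(1)] by (auto simp: pullback_def commuting_square_def)
  then have "Cod C (m \<cdot> q) = X" "Cod C (\<phi>' \<cdot> r) = Z"
    using s s' spansD[OF s(1)] spansD[OF s'(1)] by auto
  ultimately show "pfn_comp C g f \<in> Hom (pfn_cat C) X Z"
    "pfn_graph C (pfn_comp C g f) = pfn_graph C f O pfn_graph C g"
    using pfn_class_in[OF c(1)] c s s' by simp_all
qed

lemma pfn_Cmp:
  assumes "f \<in> Hom (pfn_cat C) X Y" and "g \<in> Hom (pfn_cat C) Y Z"
  shows "g \<cdot>\<^bsub>pfn_cat C\<^esub> f \<in> Hom (pfn_cat C) X Z"
    and "pfn_graph C (g \<cdot>\<^bsub>pfn_cat C\<^esub> f) = pfn_graph C f O pfn_graph C g"
  using pfn_comp[OF assms] by (simp_all add: pfn_cat_def)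

lemma pfn_category: "category (pfn_cat C)"
proof
  fix f assume "f \<in> Ar (pfn_cat C)"
  then show "Dom (pfn_cat C) f \<in> Ob (pfn_cat C)" "Cod (pfn_cat C) f \<in> Ob (pfn_cat C)"
    by (auto simp: pfn_cat_def pfn_class_def spans_def Cod_in)
next
  show "\<And>X. X \<in> Ob (pfn_cat C) \<Longrightarrow> Ide (pfn_cat C) X \<in> Hom (pfn_cat C) X X"
    using pfn_Ide_in by (simp add: pfn_cat_def)
next
  show "\<And>f X Y g Z. f \<in> Hom (pfn_cat C) X Y \<Longrightarrow> g \<in> Hom (pfn_cat C) Y Z \<Longrightarrow>
       g \<cdot>\<^bsub>pfn_cat C\<^esub> f \<in> Hom (pfn_cat C) X Z"
    by (rule pfn_Cmp)
next
  fix f X Y assume f: "f \<in> Hom (pfn_cat C) X Y"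
  then have X: "X \<in> Ob C" and Y: "Y \<in> Ob C"
    by (auto elim!: pfn_HomE simp: spans_def Cod_in)
  note g = pfn_graph_Ar[OF f]
  show "f \<cdot>\<^bsub>pfn_cat C\<^esub> Ide (pfn_cat C) X = f"
    using g by (intro pfn_eqI[OF pfn_Cmp(1)[OF pfn_Ide_in[OF X] f] f])
      (auto simp: pfn_Cmp(2)[OF pfn_Ide_in[OF X] f] pfn_graph_Ide[OF X])
  show "Ide (pfn_cat C) Y \<cdot>\<^bsub>pfn_cat C\<^esub> f = f"
    using g by (intro pfn_eqI[OF pfn_Cmp(1)[OF f pfn_Ide_in[OF Y]] f])
      (auto simp: pfn_Cmp(2)[OF f pfn_Ide_in[OF Y]] pfn_graph_Ide[OF Y])
next
  fix f W X g Y h Z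
  assume f: "f \<in> Hom (pfn_cat C) W X" and g: "g \<in> Hom (pfn_cat C) X Y"
    and h: "h \<in> Hom (pfn_cat C) Y Z"
  note fg = pfn_Cmp[OF f g] and gh = pfn_Cmp[OF g h]
  show "(h \<cdot>\<^bsub>pfn_cat C\<^esub> g) \<cdot>\<^bsub>pfn_cat C\<^esub> f = h \<cdot>\<^bsub>pfn_cat C\<^esub> (g \<cdot>\<^bsub>pfn_cat C\<^esub> f)"
    by (rule pfn_eqI[OF pfn_Cmp(1)[OF f gh(1)] pfn_Cmp(1)[OF fg(1) h]])
      (simp add: pfn_Cmp(2)[OF f gh(1)] pfn_Cmp(2)[OF fg(1) h] fg gh O_assoc)
qed

definition total_functor :: "('a, 'b, 'a, ('a, ('b \<times> 'b) set) arrow) func" where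
  "total_functor = \<lparr>onOb = \<lambda>X. X, onAr = \<lambda>\<phi>. pfn_class C (Ide C (Dom C \<phi>)) \<phi>\<rparr>"

text \<open>
  Evaluating the graph of a total morphism at the identity gives the morphism back, whence
  faithfulness.
\<close>

lemma total_faithful_embedding: "faithful_embedding C (pfn_cat C) total_functor"
  unfolding faithful_embedding_def
proof (intro conjI)
  show "inj_on (onOb total_functor) (Ob C)"
    by (simp add: total_functor_def)
  show "faithful C total_functor"
    unfolding faithful_def
  proof (intro ballI inj_onI)
    fix X Y \<phi> \<psi> assume X: "X \<in> Ob C" and h: "\<phi> \<in> Hom C X Y" "\<psi> \<in> Hom C X Y"
      and e: "onAr total_functor \<phi> = onAr total_functor \<psi>"
    have "{(z, \<phi> \<cdot> z) | z. z \<in> Ar C \<and> Cod C z = X} = {(z, \<psi> \<cdot> z) | z. z \<in> Ar C \<and> Cod C z = X}"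
      using h arg_cong[OF e, of "pfn_graph C"] by (simp add: total_functor_def pfn_graph_total Hom_def)
    moreover have "(Ide C X, \<phi> \<cdot> Ide C X) \<in> {(z, \<phi> \<cdot> z) | z. z \<in> Ar C \<and> Cod C z = X}"
      using X by auto
    ultimately have "\<phi> \<cdot> Ide C X = \<psi> \<cdot> Ide C X"
      by auto
    then show "\<phi> = \<psi>"
      using h by (simp add: Hom_def)
  qed
  have in_Hom: "onAr total_functor \<phi> \<in> Hom (pfn_cat C) X Y" if "\<phi> \<in> Hom C X Y" for \<phi> X Y
    using pfn_class_in[OF Ide_span, of \<phi> X] that Dom_in[of \<phi>] by (auto simp: total_functor_def Hom_def)
  have graph: "pfn_graph C (onAr total_functor \<phi>) = {(z, \<phi> \<cdot> z) | z. z \<in> Ar C \<and> Cod C z = X}"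
    if "\<phi> \<in> Hom C X Y" for \<phi> X Y
    using that by (simp add: total_functor_def pfn_graph_total Hom_def)
  interpret P: category "pfn_cat C"
    by (rule pfn_category)
  show "cat_functor C (pfn_cat C) total_functor"
  proof
    show "onAr total_functor \<phi> \<in> Hom (pfn_cat C) (onOb total_functor X) (onOb total_functor Y)"
      if "\<phi> \<in> Hom C X Y" for \<phi> X Y
      using in_Hom[OF that] by (simp add: total_functor_def)
  next
    fix \<phi> X Y \<psi> Z assume h: "\<phi> \<in> Hom C X Y" "\<psi> \<in> Hom C Y Z"
    show "onAr total_functor (\<psi> \<cdot> \<phi>) = onAr total_functor \<psi> \<cdot>\<^bsub>pfn_cat C\<^esub> onAr total_functor \<phi>"
    proof (rule pfn_eqI[OF in_Hom[OF Cmp_in[OF h]] pfn_Cmp(1)[OF in_Hom[OF h(1)] in_Hom[OF h(2)]]])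
      show "pfn_graph C (onAr total_functor (\<psi> \<cdot> \<phi>)) =
        pfn_graph C (onAr total_functor \<psi> \<cdot>\<^bsub>pfn_cat C\<^esub> onAr total_functor \<phi>)"
        unfolding pfn_Cmp(2)[OF in_Hom[OF h(1)] in_Hom[OF h(2)]] graph[OF Cmp_in[OF h]]
          graph[OF h(1)] graph[OF h(2)]
        using h by (auto simp: Hom_def assoc relcomp_unfold)
    qed
  qed (auto simp: total_functor_def pfn_cat_def)
qed

end

section \<open>Products of partial morphisms\<close>

locale category_with_products = category +
  fixes P :: "'a \<Rightarrow> 'a \<Rightarrow> 'b \<times> 'b"
  assumes products: "binary_products C P"
begin

abbreviation prod_object (infixl "\<otimes>" 75) where "X \<otimes> Y \<equiv> prod_ob C P X Y"
abbreviation proj1 where "proj1 X Y \<equiv> fst (P X Y)"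
abbreviation proj2 where "proj2 X Y \<equiv> snd (P X Y)"

lemma proj [simp]:
  assumes "X \<in> Ob C" "Y \<in> Ob C"
  shows "proj1 X Y \<in> Ar C" "Dom C (proj1 X Y) = X \<otimes> Y" "Cod C (proj1 X Y) = X"
    "proj2 X Y \<in> Ar C" "Dom C (proj2 X Y) = X \<otimes> Y" "Cod C (proj2 X Y) = Y"
    "X \<otimes> Y \<in> Ob C"
  using products assms Dom_in by (auto simp: binary_products_def is_product_def Hom_def prod_ob_def)

lemma pairing_ex1:
  assumes "X \<in> Ob C" "Y \<in> Ob C" "f \<in> Ar C" "g \<in> Ar C" "Dom C f = Dom C g" "Cod C f = X" "Cod C g = Y"
  shows "\<exists>!h. h \<in> Hom C (Dom C f) (X \<otimes> Y) \<and> proj1 X Y \<cdot> h = f \<and> proj2 X Y \<cdot> h = g"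
proof -
  have "is_product C X Y (proj1 X Y) (proj2 X Y)"
    using products assms by (auto simp: binary_products_def)
  then show ?thesis
    unfolding is_product_def prod_ob_def using assms Dom_in[of f] by (simp add: Hom_def)
qed

lemma joint_monic:
  assumes "X \<in> Ob C" "Y \<in> Ob C" "f \<in> Ar C" "g \<in> Ar C" "Dom C f = Dom C g"
    "Cod C f = X \<otimes> Y" "Cod C g = X \<otimes> Y"
    "proj1 X Y \<cdot> f = proj1 X Y \<cdot> g" "proj2 X Y \<cdot> f = proj2 X Y \<cdot> g"
  shows "f = g"
proof -
  have "\<exists>!h. h \<in> Hom C (Dom C (proj1 X Y \<cdot> g)) (X \<otimes> Y) \<and>
      proj1 X Y \<cdot> h = proj1 X Y \<cdot> g \<and> proj2 X Y \<cdot> h = proj2 X Y \<cdot> g"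
    using assms by (intro pairing_ex1) auto
  moreover have "f \<in> Hom C (Dom C (proj1 X Y \<cdot> g)) (X \<otimes> Y)" "g \<in> Hom C (Dom C (proj1 X Y \<cdot> g)) (X \<otimes> Y)"
    using assms by (auto simp: Hom_def)
  ultimately show ?thesis
    using assms by metis
qed

lemma prod_ar:
  assumes f: "f \<in> Ar C" and g: "g \<in> Ar C"
  shows "prod_ar C P f g \<in> Ar C"
    "Dom C (prod_ar C P f g) = Dom C f \<otimes> Dom C g" "Cod C (prod_ar C P f g) = Cod C f \<otimes> Cod C g"
    "proj1 (Cod C f) (Cod C g) \<cdot> prod_ar C P f g = f \<cdot> proj1 (Dom C f) (Dom C g)"
    "proj2 (Cod C f) (Cod C g) \<cdot> prod_ar C P f g = g \<cdot> proj2 (Dom C f) (Dom C g)"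
proof -
  note o = Dom_in[OF f] Dom_in[OF g] Cod_in[OF f] Cod_in[OF g]
  let ?p = "f \<cdot> proj1 (Dom C f) (Dom C g)" and ?q = "g \<cdot> proj2 (Dom C f) (Dom C g)"
  have "\<exists>!h. h \<in> Hom C (Dom C ?p) (Cod C f \<otimes> Cod C g) \<and>
      proj1 (Cod C f) (Cod C g) \<cdot> h = ?p \<and> proj2 (Cod C f) (Cod C g) \<cdot> h = ?q"
    using f g o by (intro pairing_ex1) auto
  then have "\<exists>!h. h \<in> Hom C (Dom C f \<otimes> Dom C g) (Cod C f \<otimes> Cod C g) \<and>
      proj1 (Cod C f) (Cod C g) \<cdot> h = ?p \<and> proj2 (Cod C f) (Cod C g) \<cdot> h = ?q"
    using f g o by simp
  from theI'[OF this] show "prod_ar C P f g \<in> Ar C"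
    "Dom C (prod_ar C P f g) = Dom C f \<otimes> Dom C g" "Cod C (prod_ar C P f g) = Cod C f \<otimes> Cod C g"
    "proj1 (Cod C f) (Cod C g) \<cdot> prod_ar C P f g = f \<cdot> proj1 (Dom C f) (Dom C g)"
    "proj2 (Cod C f) (Cod C g) \<cdot> prod_ar C P f g = g \<cdot> proj2 (Dom C f) (Dom C g)"
    by (simp_all add: prod_ar_def Hom_def Let_def)
qed

lemma prod_ar_Ide:
  assumes "X \<in> Ob C" "Y \<in> Ob C"
  shows "prod_ar C P (Ide C X) (Ide C Y) = Ide C (X \<otimes> Y)"
  using prod_ar[of "Ide C X" "Ide C Y"] assms by - (rule joint_monic[of X Y], auto)

lemma proj_prod_ar:
  assumes f: "f \<in> Ar C" and g: "g \<in> Ar C" and z: "z \<in> Ar C" "Cod C z = Dom C f \<otimes> Dom C g"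
  shows "proj1 (Cod C f) (Cod C g) \<cdot> (prod_ar C P f g \<cdot> z) = f \<cdot> (proj1 (Dom C f) (Dom C g) \<cdot> z)"
    "proj2 (Cod C f) (Cod C g) \<cdot> (prod_ar C P f g \<cdot> z) = g \<cdot> (proj2 (Dom C f) (Dom C g) \<cdot> z)"
proof -
  note o = Dom_in[OF f] Dom_in[OF g] Cod_in[OF f] Cod_in[OF g]
  note pa = prod_ar[OF f g]
  show "proj1 (Cod C f) (Cod C g) \<cdot> (prod_ar C P f g \<cdot> z) = f \<cdot> (proj1 (Dom C f) (Dom C g) \<cdot> z)"
    using f g z o pa(1-3) by (simp add: pa(4) flip: assoc)
  show "proj2 (Cod C f) (Cod C g) \<cdot> (prod_ar C P f g \<cdot> z) = g \<cdot> (proj2 (Dom C f) (Dom C g) \<cdot> z)"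
    using f g z o pa(1-3) by (simp add: pa(5) flip: assoc)
qed

text \<open>
  Both components of an arrow into a product can be cancelled separately.
\<close>

lemma prod_ar_monic:
  assumes m: "monic C m" and n: "monic C n"
  shows "monic C (prod_ar C P m n)"
proof -
  have mn: "m \<in> Ar C" "n \<in> Ar C"
    using m n by auto
  note o = Dom_in[OF mn(1)] Dom_in[OF mn(2)] Cod_in[OF mn(1)] Cod_in[OF mn(2)]
  note pa = prod_ar[OF mn]
  show ?thesis
  proof (rule monicI)
    fix f g assume f: "f \<in> Ar C" "Cod C f = Dom C (prod_ar C P m n)"
      and g: "g \<in> Ar C" "Cod C g = Dom C (prod_ar C P m n)"
      and d: "Dom C f = Dom C g" and e: "prod_ar C P m n \<cdot> f = prod_ar C P m n \<cdot> g"
    have f': "Cod C f = Dom C m \<otimes> Dom C n" and g': "Cod C g = Dom C m \<otimes> Dom C n"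
      using f g pa by auto
    have "m \<cdot> (proj1 (Dom C m) (Dom C n) \<cdot> f) = m \<cdot> (proj1 (Dom C m) (Dom C n) \<cdot> g)"
      using proj_prod_ar(1)[OF mn f(1) f'] proj_prod_ar(1)[OF mn g(1) g'] e by simp
    then have 1: "proj1 (Dom C m) (Dom C n) \<cdot> f = proj1 (Dom C m) (Dom C n) \<cdot> g"
      using f g f' g' d o by - (rule monicD[OF m], auto)
    have "n \<cdot> (proj2 (Dom C m) (Dom C n) \<cdot> f) = n \<cdot> (proj2 (Dom C m) (Dom C n) \<cdot> g)"
      using proj_prod_ar(2)[OF mn f(1) f'] proj_prod_ar(2)[OF mn g(1) g'] e by simp
    then have 2: "proj2 (Dom C m) (Dom C n) \<cdot> f = proj2 (Dom C m) (Dom C n) \<cdot> g"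
      using f g f' g' d o by - (rule monicD[OF n], auto)
    show "f = g"
      using f g f' g' d o 1 2 by - (rule joint_monic[of "Dom C m" "Dom C n"], auto)
  qed (rule pa)
qed

text \<open>
  Products commute with the passage to generalized elements: an arrow into \<open>X \<otimes> X'\<close> is a pair
  of arrows, and such pairs are related componentwise.
\<close>

definition graph_prod :: "'a \<Rightarrow> 'a \<Rightarrow> 'a \<Rightarrow> 'a \<Rightarrow> ('b \<times> 'b) set \<Rightarrow> ('b \<times> 'b) set \<Rightarrow> ('b \<times> 'b) set" where
  "graph_prod X Y X' Y' R S = {(a, c). a \<in> Ar C \<and> c \<in> Ar C \<and> Dom C a = Dom C c \<and>
     Cod C a = X \<otimes> X' \<and> Cod C c = Y \<otimes> Y' \<and>
     (proj1 X X' \<cdot> a, proj1 Y Y' \<cdot> c) \<in> R \<and> (proj2 X X' \<cdot> a, proj2 Y Y' \<cdot> c) \<in> S}"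

text \<open>
  If the components of \<open>a\<close> and \<open>c\<close> are related through \<open>x\<close> and \<open>x'\<close>, then \<open>a\<close> and \<open>c\<close> are
  related through the pairing of \<open>x\<close> and \<open>x'\<close>.
\<close>

lemma span_graph_prod:
  assumes s: "(m, \<phi>) \<in> spans C" and s': "(m', \<phi>') \<in> spans C"
  shows "(prod_ar C P m m', prod_ar C P \<phi> \<phi>') \<in> spans C"
    and "span_graph C (prod_ar C P m m') (prod_ar C P \<phi> \<phi>') =
      graph_prod (Cod C m) (Cod C \<phi>) (Cod C m') (Cod C \<phi>') (span_graph C m \<phi>) (span_graph C m' \<phi>')"
proof -
  note m = spansD[OF s] and m' = spansD[OF s']
  note o = Dom_in[OF m(2)] Cod_in[OF m(2)] Cod_in[OF m(3)]
    Dom_in[OF m'(2)] Cod_in[OF m'(2)] Cod_in[OF m'(3)]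
  note pm = prod_ar[OF m(2) m'(2)] and pf = prod_ar[OF m(3) m'(3)]
  let ?U = "Dom C m" and ?U' = "Dom C m'"
  show "(prod_ar C P m m', prod_ar C P \<phi> \<phi>') \<in> spans C"
    using prod_ar_monic[OF m(1) m'(1)] pm pf m m' by (auto simp: spans_def)
  show "span_graph C (prod_ar C P m m') (prod_ar C P \<phi> \<phi>') =
      graph_prod (Cod C m) (Cod C \<phi>) (Cod C m') (Cod C \<phi>') (span_graph C m \<phi>) (span_graph C m' \<phi>')"
  proof (intro equalityI subsetI)
    fix w assume "w \<in> span_graph C (prod_ar C P m m') (prod_ar C P \<phi> \<phi>')"
    then obtain z where z: "z \<in> Ar C" "Cod C z = ?U \<otimes> ?U'"
      and w: "w = (prod_ar C P m m' \<cdot> z, prod_ar C P \<phi> \<phi>' \<cdot> z)"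
      using pm by (auto simp: span_graph_def)
    have z': "Cod C z = Dom C \<phi> \<otimes> Dom C \<phi>'"
      using z m m' by simp
    have "(m \<cdot> (proj1 ?U ?U' \<cdot> z), \<phi> \<cdot> (proj1 ?U ?U' \<cdot> z)) \<in> span_graph C m \<phi>"
      using z o by (auto simp: span_graph_def intro!: exI[of _ "proj1 ?U ?U' \<cdot> z"])
    moreover have "(m' \<cdot> (proj2 ?U ?U' \<cdot> z), \<phi>' \<cdot> (proj2 ?U ?U' \<cdot> z)) \<in> span_graph C m' \<phi>'"
      using z o by (auto simp: span_graph_def intro!: exI[of _ "proj2 ?U ?U' \<cdot> z"])
    ultimately show "w \<in> graph_prod (Cod C m) (Cod C \<phi>) (Cod C m') (Cod C \<phi>')
        (span_graph C m \<phi>) (span_graph C m' \<phi>')"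
      unfolding w graph_prod_def
      using z z' pm(1-3) pf(1-3) m m' proj_prod_ar[OF m(2) m'(2) z] proj_prod_ar[OF m(3) m'(3) z(1) z']
      by simp
  next
    fix w assume "w \<in> graph_prod (Cod C m) (Cod C \<phi>) (Cod C m') (Cod C \<phi>')
        (span_graph C m \<phi>) (span_graph C m' \<phi>')"
    then obtain a c x x' where w: "w = (a, c)" and ac: "a \<in> Ar C" "c \<in> Ar C" "Dom C a = Dom C c"
       "Cod C a = Cod C m \<otimes> Cod C m'" "Cod C c = Cod C \<phi> \<otimes> Cod C \<phi>'"
      and x: "x \<in> Ar C" "Cod C x = ?U" "proj1 (Cod C m) (Cod C m') \<cdot> a = m \<cdot> x"
       "proj1 (Cod C \<phi>) (Cod C \<phi>') \<cdot> c = \<phi> \<cdot> x"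
      and x': "x' \<in> Ar C" "Cod C x' = ?U'" "proj2 (Cod C m) (Cod C m') \<cdot> a = m' \<cdot> x'"
       "proj2 (Cod C \<phi>) (Cod C \<phi>') \<cdot> c = \<phi>' \<cdot> x'"
      by (auto simp: graph_prod_def span_graph_def)
    have "Dom C (m \<cdot> x) = Dom C a" "Dom C (m' \<cdot> x') = Dom C a"
      using ac o by (simp_all flip: x(3) x'(3))
    then have d: "Dom C x = Dom C a" "Dom C x' = Dom C a"
      using x x' m m' by simp_all
    obtain z where z: "z \<in> Ar C" "Dom C z = Dom C x" "Cod C z = ?U \<otimes> ?U'"
      "proj1 ?U ?U' \<cdot> z = x" "proj2 ?U ?U' \<cdot> z = x'"
      using pairing_ex1[of ?U ?U' x x'] o x x' d by (auto simp: Hom_def)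
    have z': "Cod C z = Dom C \<phi> \<otimes> Dom C \<phi>'"
      using z m m' by simp
    have "prod_ar C P m m' \<cdot> z = a"
      using proj_prod_ar[OF m(2) m'(2) z(1,3)] z ac x x' d pm(1-3) o
    by - (rule joint_monic[of "Cod C m" "Cod C m'"], auto)
    moreover have "prod_ar C P \<phi> \<phi>' \<cdot> z = c"
      using proj_prod_ar[OF m(3) m'(3) z(1) z'] z z' ac x x' d pf(1-3) o m m'
    by - (rule joint_monic[of "Cod C \<phi>" "Cod C \<phi>'"], auto)
    ultimately show "w \<in> span_graph C (prod_ar C P m m') (prod_ar C P \<phi> \<phi>')"
      using w z pm by (auto simp: span_graph_def)
  qed
qed

text \<open>
  A chosen representative. Since the graph of the product depends only on the graphs of the factors,
  the choice has no influence on the bifunctor below.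
\<close>

definition pfn_rep :: "('a, ('b \<times> 'b) set) arrow \<Rightarrow> 'b \<times> 'b" where
  "pfn_rep f = (SOME s. s \<in> spans C \<and> f = pfn_class C (fst s) (snd s))"

definition pfn_prod :: "('a \<times> 'a, ('a, ('b \<times> 'b) set) arrow \<times> ('a, ('b \<times> 'b) set) arrow,
    'a, ('a, ('b \<times> 'b) set) arrow) func" where
  "pfn_prod = \<lparr>onOb = \<lambda>(X, Y). X \<otimes> Y,
     onAr = \<lambda>(f, g). case (pfn_rep f, pfn_rep g) of ((m, \<phi>), (m', \<phi>')) \<Rightarrow>
       pfn_class C (prod_ar C P m m') (prod_ar C P \<phi> \<phi>')\<rparr>"

lemma pfn_prod_ob: "onOb pfn_prod (X, Y) = X \<otimes> Y"
  by (simp add: pfn_prod_def)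

lemma pfn_rep:
  assumes "f \<in> Hom (pfn_cat C) X Y" "pfn_rep f = (m, \<phi>)"
  shows "(m, \<phi>) \<in> spans C" "f = pfn_class C m \<phi>" "Cod C m = X" "Cod C \<phi> = Y"
proof -
  have "\<exists>s. s \<in> spans C \<and> f = pfn_class C (fst s) (snd s)"
    using assms(1) by (rule pfn_HomE) (metis fst_conv snd_conv)
  from someI_ex[OF this] show "(m, \<phi>) \<in> spans C" "f = pfn_class C m \<phi>"
    using assms(2) by (simp_all add: pfn_rep_def)
  then show "Cod C m = X" "Cod C \<phi> = Y"
    using assms(1) by (auto simp: Hom_def pfn_cat_def pfn_class_def)
qed

lemma pfn_prod_ar:
  assumes f: "f \<in> Hom (pfn_cat C) X Y" and g: "g \<in> Hom (pfn_cat C) X' Y'"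
  shows "onAr pfn_prod (f, g) \<in> Hom (pfn_cat C) (X \<otimes> X') (Y \<otimes> Y')"
    and "pfn_graph C (onAr pfn_prod (f, g)) = graph_prod X Y X' Y' (pfn_graph C f) (pfn_graph C g)"
proof -
  obtain m \<phi> m' \<phi>' where r: "pfn_rep f = (m, \<phi>)" "pfn_rep g = (m', \<phi>')"
    by (metis surj_pair)
  note s = pfn_rep[OF f r(1)] and s' = pfn_rep[OF g r(2)]
  note sp = span_graph_prod[OF s(1) s'(1)]
  have e: "onAr pfn_prod (f, g) = pfn_class C (prod_ar C P m m') (prod_ar C P \<phi> \<phi>')"
    using r by (simp add: pfn_prod_def)
  show "onAr pfn_prod (f, g) \<in> Hom (pfn_cat C) (X \<otimes> X') (Y \<otimes> Y')"
    unfolding e using pfn_class_in[OF sp(1)] s(3,4) s'(3,4) prod_ar(3) spansD[OF s(1)] spansD[OF s'(1)] by simp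
  show "pfn_graph C (onAr pfn_prod (f, g)) = graph_prod X Y X' Y' (pfn_graph C f) (pfn_graph C g)"
    unfolding e using sp s s' by simp
qed

lemma pfn_prod_class:
  assumes s: "(m, \<phi>) \<in> spans C" and s': "(m', \<phi>') \<in> spans C"
  shows "onAr pfn_prod (pfn_class C m \<phi>, pfn_class C m' \<phi>') =
    pfn_class C (prod_ar C P m m') (prod_ar C P \<phi> \<phi>')"
  using span_graph_prod[OF s s'] s s' pfn_prod_ar[OF pfn_class_in[OF s] pfn_class_in[OF s']]
  by (intro pfn_eqI[OF _ pfn_class_in]) auto

end

locale category_with_monic_pullbacks_and_products =
  category_with_monic_pullbacks C + category_with_products C P
  for C :: "('a, 'b) cat" (structure) and P
begin

text \<open>
  By the graphs, this is the compatibility of relational composition with componentwise relations.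
  The interesting inclusion pairs the two intermediate elements into one.
\<close>

lemma pfn_prod_functor: "cat_functor (prod_cat (pfn_cat C) (pfn_cat C)) (pfn_cat C) pfn_prod"
proof -
  interpret Q: category "pfn_cat C"
    by (rule pfn_category)
  let ?Q = "prod_cat (pfn_cat C) (pfn_cat C)"
  have HomQ: "h \<in> Hom ?Q X Y \<longleftrightarrow> fst h \<in> Hom (pfn_cat C) (fst X) (fst Y) \<and>
      snd h \<in> Hom (pfn_cat C) (snd X) (snd Y)" for h X Y
    by (cases h; cases X; cases Y) (auto simp: Hom_def prod_cat_def)
  have obQ: "X \<in> Ob ?Q \<longleftrightarrow> fst X \<in> Ob C \<and> snd X \<in> Ob C" for X
    by (cases X) (auto simp: prod_cat_def pfn_cat_def)
  have IdeQ: "Ide ?Q X = (Ide (pfn_cat C) (fst X), Ide (pfn_cat C) (snd X))" for X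
    by (cases X) (auto simp: prod_cat_def)
  have CmpQ: "g \<cdot>\<^bsub>?Q\<^esub> f = (fst g \<cdot>\<^bsub>pfn_cat C\<^esub> fst f, snd g \<cdot>\<^bsub>pfn_cat C\<^esub> snd f)" for f g
    by (cases f; cases g) (auto simp: prod_cat_def)
  interpret Q2: category ?Q
  proof
    fix f assume f: "f \<in> Ar ?Q"
    then show "Dom ?Q f \<in> Ob ?Q" "Cod ?Q f \<in> Ob ?Q"
      by (auto simp: prod_cat_def Q.Dom_in Q.Cod_in)
  next
    show "Ide ?Q X \<in> Hom ?Q X X" if "X \<in> Ob ?Q" for X
      using that pfn_Ide_in by (simp add: HomQ obQ IdeQ)
  next
    show "g \<cdot>\<^bsub>?Q\<^esub> f \<in> Hom ?Q X Z" if "f \<in> Hom ?Q X Y" "g \<in> Hom ?Q Y Z" for f g X Y Z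
      using that by (auto simp: HomQ CmpQ intro: Q.Cmp_in)
  next
    show "f \<cdot>\<^bsub>?Q\<^esub> Ide ?Q X = f" "Ide ?Q Y \<cdot>\<^bsub>?Q\<^esub> f = f" if "f \<in> Hom ?Q X Y" for f X Y
      using that by (auto simp: HomQ CmpQ IdeQ prod_eq_iff intro: Q.Cmp_Ide Q.Ide_Cmp)
  next
    show "(h \<cdot>\<^bsub>?Q\<^esub> g) \<cdot>\<^bsub>?Q\<^esub> f = h \<cdot>\<^bsub>?Q\<^esub> (g \<cdot>\<^bsub>?Q\<^esub> f)"
      if "f \<in> Hom ?Q W X" "g \<in> Hom ?Q X Y" "h \<in> Hom ?Q Y Z" for f g h W X Y Z
      using that by (auto simp: HomQ CmpQ prod_eq_iff intro: Q.Cmp_assoc)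
  qed
  show ?thesis
  proof
    show "onOb pfn_prod X \<in> Ob (pfn_cat C)" if "X \<in> Ob ?Q" for X
      using that[unfolded obQ] by (cases X) (simp add: pfn_prod_def pfn_cat_def)
  next
    show "onAr pfn_prod f \<in> Hom (pfn_cat C) (onOb pfn_prod X) (onOb pfn_prod Y)"
      if "f \<in> Hom ?Q X Y" for f X Y
      using that pfn_prod_ar(1)[of "fst f" "fst X" "fst Y" "snd f" "snd X" "snd Y"]
      by (cases X; cases Y) (auto simp: HomQ pfn_prod_def)
  next
    fix X assume "X \<in> Ob ?Q"
    then obtain A B where X: "X = (A, B)" "A \<in> Ob C" "B \<in> Ob C"
      by (cases X) (auto simp: obQ)
    have AB: "A \<otimes> B \<in> Ob C"
      using X by simp
    show "onAr pfn_prod (Ide ?Q X) = Ide (pfn_cat C) (onOb pfn_prod X)"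
      using pfn_prod_class[OF Ide_span Ide_span, of "Ide C A" A "Ide C B" B] X
      by (simp add: IdeQ pfn_Ide pfn_prod_ob prod_ar_Ide)
  next
    fix h X Y k Z assume h: "h \<in> Hom ?Q X Y" and k: "k \<in> Hom ?Q Y Z"
    obtain f f' g g' A A' B B' D D' where e: "h = (f, f')" "k = (g, g')"
      "X = (A, A')" "Y = (B, B')" "Z = (D, D')"
      by (metis surj_pair)
    have f: "f \<in> Hom (pfn_cat C) A B" "f' \<in> Hom (pfn_cat C) A' B'"
      and g: "g \<in> Hom (pfn_cat C) B D" "g' \<in> Hom (pfn_cat C) B' D'"
      using h k by (auto simp: e HomQ)
    have o: "A \<in> Ob C" "A' \<in> Ob C" "B \<in> Ob C" "B' \<in> Ob C" "D \<in> Ob C" "D' \<in> Ob C"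
      using f g Q.Dom_in Q.Cod_in by (auto simp: Hom_def pfn_cat_def)
    note pf = pfn_prod_ar[OF f] and pg = pfn_prod_ar[OF g]
    note c = pfn_Cmp[OF f(1) g(1)] and c' = pfn_Cmp[OF f(2) g(2)]
    note pc = pfn_prod_ar[OF c(1) c'(1)] and cp = pfn_Cmp[OF pf(1) pg(1)]
    show "onAr pfn_prod (k \<cdot>\<^bsub>?Q\<^esub> h) = onAr pfn_prod k \<cdot>\<^bsub>pfn_cat C\<^esub> onAr pfn_prod h"
      unfolding e CmpQ fst_conv snd_conv
    proof (rule pfn_eqI[OF pc(1) cp(1)], unfold pc(2) cp(2) c(2) c'(2) pf(2) pg(2),
        intro equalityI subsetI)
      fix w assume "w \<in> graph_prod A D A' D' (pfn_graph C f O pfn_graph C g) (pfn_graph C f' O pfn_graph C g')"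
      then obtain a d b b' where w: "w = (a, d)" and ad: "a \<in> Ar C" "d \<in> Ar C" "Dom C a = Dom C d"
        "Cod C a = A \<otimes> A'" "Cod C d = D \<otimes> D'"
        and b: "(proj1 A A' \<cdot> a, b) \<in> pfn_graph C f" "(b, proj1 D D' \<cdot> d) \<in> pfn_graph C g"
        and b': "(proj2 A A' \<cdot> a, b') \<in> pfn_graph C f'" "(b', proj2 D D' \<cdot> d) \<in> pfn_graph C g'"
        by (auto simp: graph_prod_def)
      note bA = pfn_graph_Ar[OF f(1) b(1)] and bA' = pfn_graph_Ar[OF f(2) b'(1)]
      obtain z where "z \<in> Ar C" "Dom C z = Dom C a" "Cod C z = B \<otimes> B'"
        "proj1 B B' \<cdot> z = b" "proj2 B B' \<cdot> z = b'"
        using pairing_ex1[of B B' b b'] o bA bA' ad by (auto simp: Hom_def)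
      then show "w \<in> graph_prod A B A' B' (pfn_graph C f) (pfn_graph C f') O
          graph_prod B D B' D' (pfn_graph C g) (pfn_graph C g')"
        using w ad b b' by (auto simp: graph_prod_def intro!: relcompI[of a z _ d])
    next
      fix w assume "w \<in> graph_prod A B A' B' (pfn_graph C f) (pfn_graph C f') O
          graph_prod B D B' D' (pfn_graph C g) (pfn_graph C g')"
      then show "w \<in> graph_prod A D A' D' (pfn_graph C f O pfn_graph C g) (pfn_graph C f' O pfn_graph C g')"
        by (auto simp: graph_prod_def)
    qed
  qed
qed

lemma pfn_prod_total:
  assumes "\<phi> \<in> Ar C" "\<psi> \<in> Ar C"
  shows "onAr pfn_prod (onAr total_functor \<phi>, onAr total_functor \<psi>) = onAr total_functor (prod_ar C P \<phi> \<psi>)"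
  using pfn_prod_class[OF Ide_span Ide_span, OF assms(1) refl assms(2) refl] prod_ar[OF assms] assms
  by (simp add: total_functor_def prod_ar_Ide Dom_in)

end

section \<open>Small sets\<close>

text \<open>
  Smallness relative to the type \<open>'u\<close> for sets over an arbitrary type. It lets one count families
  of sets, functions and coalgebras, which are not themselves subsets of \<open>'u\<close>.
\<close>

definition small_for :: "'u itself \<Rightarrow> 'b set \<Rightarrow> bool" where
  "small_for (U :: 'u itself) B \<longleftrightarrow> |B| <o |UNIV :: 'u set|"

locale set_universe =
  fixes U :: "'u itself"
  assumes univ: "universe U"
begin

abbreviation tiny :: "'b set \<Rightarrow> bool" where
  "tiny B \<equiv> small_for U B"

lemma small_iff_tiny: "small (A :: 'u set) \<longleftrightarrow> tiny A"
  by (simp add: small_def small_for_def)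

lemma infinite_U: "infinite (UNIV :: 'u set)"
  using univ by (simp add: universe_def)

lemma tiny_subset: "tiny B \<Longrightarrow> A \<subseteq> B \<Longrightarrow> tiny A"
  unfolding small_for_def using card_of_mono1 ordLeq_ordLess_trans by blast

lemma tiny_image: "tiny B \<Longrightarrow> tiny (f ` B)"
  unfolding small_for_def using card_of_image ordLeq_ordLess_trans by blast

lemma tiny_finite: "finite B \<Longrightarrow> tiny B"
  using infinite_U finite_ordLess_infinite[OF card_of_Well_order[of B] card_of_Well_order[of "UNIV :: 'u set"]]
  by (simp add: small_for_def Field_card_of)

lemma stable_card:
  assumes "infinite K" "regularCard |K|"
  shows "stable |K|"
  using regularCard_stable[OF card_of_Card_order] assms by (simp add: Field_card_of)

text \<open>
  This is where the regularity of the universe enters.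
\<close>

lemma tiny_Sigma: "tiny I \<Longrightarrow> (\<And>i. i \<in> I \<Longrightarrow> tiny (A i)) \<Longrightarrow> tiny (Sigma I A)"
  unfolding small_for_def using univ
  by (intro stable_elim[OF stable_card]) (simp_all add: universe_def)

text \<open>
  Objects built as sets of pairs or triples have to be copied into \<open>'u\<close> before they can carry a
  coalgebra structure.
\<close>

lemma tiny_encode:
  assumes "tiny (B :: 'b set)"
  obtains e :: "'b \<Rightarrow> 'u" where "inj_on e B" "small (e ` B)"
proof -
  obtain e :: "'b \<Rightarrow> 'u" where "inj_on e B"
    using ordLess_imp_ordLeq[OF assms[unfolded small_for_def]] by (auto simp flip: card_of_ordLeq)
  then show ?thesis
    using that tiny_image[OF assms, of e] by (simp add: small_iff_tiny)
qed

lemma tiny_Pow: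
  assumes "tiny (B :: 'b set)"
  shows "tiny (Pow B)"
proof -
  obtain e :: "'b \<Rightarrow> 'u" where e: "inj_on e B" "small (e ` B)"
    using assms by (rule tiny_encode)
  have "|Pow B| \<le>o |Pow (e ` B)|"
    using e(1) inj_on_image_Pow[OF e(1)] by (auto simp flip: card_of_ordLeq intro!: exI[of _ "image e"])
  moreover have "tiny (Pow (e ` B))"
    using univ e(2) by (simp add: universe_def small_for_def)
  ultimately show ?thesis
    unfolding small_for_def using ordLeq_ordLess_trans by blast
qed

lemma tiny_PiE:
  assumes "tiny A" "tiny B"
  shows "tiny (A \<rightarrow>\<^sub>E B)"
proof -
  have "inj_on (\<lambda>f. (\<lambda>x. (x, f x)) ` A) (A \<rightarrow>\<^sub>E B)"
  proof (rule inj_onI)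
    fix f g assume fg: "f \<in> A \<rightarrow>\<^sub>E B" "g \<in> A \<rightarrow>\<^sub>E B"
      and e: "(\<lambda>x. (x, f x)) ` A = (\<lambda>x. (x, g x)) ` A"
    show "f = g"
    proof (rule PiE_ext[OF fg])
      fix x assume "x \<in> A"
      then have "(x, f x) \<in> (\<lambda>x. (x, g x)) ` A"
        using e by blast
      then show "f x = g x"
        by auto
    qed
  qed
  moreover have "(\<lambda>f. (\<lambda>x. (x, f x)) ` A) ` (A \<rightarrow>\<^sub>E B) \<subseteq> Pow (A \<times> B)"
    by auto
  ultimately have "|A \<rightarrow>\<^sub>E B| \<le>o |Pow (A \<times> B)|"
    using card_of_ordLeq by blast
  then show ?thesis
    using tiny_Pow[OF tiny_Sigma[of A "\<lambda>_. B"]] assms ordLeq_ordLess_trans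
    unfolding small_for_def by blast
qed

end

section \<open>Maps between small sets\<close>

abbreviation set_arrow :: "'u set \<Rightarrow> ('u \<Rightarrow> 'u) \<Rightarrow> 'u set \<Rightarrow> 'u smap" where
  "set_arrow A f B \<equiv> Arrow A (restrict f A) B"

lemma set_Ob [simp]: "A \<in> Ob set_cat \<longleftrightarrow> small A"
  by (simp add: set_cat_def)

lemma restrict_eq_restrict_iff [simp]: "restrict f A = restrict g A \<longleftrightarrow> (\<forall>x\<in>A. f x = g x)"
  by (auto simp: restrict_def fun_eq_iff)

lemma set_arrow_in_Hom [simp]:
  "set_arrow A f B \<in> Hom set_cat A' B' \<longleftrightarrow> A' = A \<and> B' = B \<and> small A \<and> small B \<and> f \<in> A \<rightarrow> B"
  by (auto simp: Hom_def set_cat_def)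

lemma set_arrow_in_Ar [simp]:
  "set_arrow A f B \<in> Ar set_cat \<longleftrightarrow> small A \<and> small B \<and> f \<in> A \<rightarrow> B"
  by (auto simp: set_cat_def)

lemma set_Dom_Cod [simp]: "Dom set_cat = src" "Cod set_cat = tgt"
  by (simp_all add: set_cat_def)

lemma set_HomE:
  assumes "h \<in> Hom set_cat A B"
  obtains f where "h = set_arrow A f B" "f \<in> A \<rightarrow> B" "small A" "small B"
proof -
  obtain f where f: "h = Arrow A f B" "f \<in> A \<rightarrow>\<^sub>E B" "small A" "small B"
    using assms by (auto simp: Hom_def set_cat_def)
  then have "restrict f A = f"
    by (simp add: PiE_iff extensional_restrict)
  then show ?thesis
    using that[of f] f by auto
qed

lemma set_arrow_eq: "set_arrow A f B = set_arrow A g B \<longleftrightarrow> (\<forall>x\<in>A. f x = g x)"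
  by simp

lemma set_Cmp [simp]:
  assumes "f \<in> A \<rightarrow> B"
  shows "Cmp set_cat (set_arrow B g D) (set_arrow A f B) = set_arrow A (g \<circ> f) D"
  using assms by (auto simp: set_cat_def compose_def fun_eq_iff)

lemma set_Ide [simp]: "Ide set_cat A = set_arrow A (\<lambda>x. x) A"
  by (simp add: set_cat_def)

text \<open>
  Stated for an arbitrary set \<open>P\<close> in place of the set of pairs, because the pairs have to be encoded,
  and because the trivial case \<open>P = A\<close> handles injective maps.
\<close>

lemma set_pullbackI:
  assumes "small A" "small B" "small D" "small P"
    and f: "f \<in> A \<rightarrow> D" and g: "g \<in> B \<rightarrow> D" and p: "p \<in> P \<rightarrow> A" and q: "q \<in> P \<rightarrow> B"
    and sq: "\<And>w. w \<in> P \<Longrightarrow> f (p w) = g (q w)"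
    and ex1: "\<And>a b. a \<in> A \<Longrightarrow> b \<in> B \<Longrightarrow> f a = g b \<Longrightarrow> \<exists>!w. w \<in> P \<and> p w = a \<and> q w = b"
  shows "pullback set_cat (set_arrow A f D) (set_arrow B g D) (set_arrow P p A) (set_arrow P q B)"
  unfolding pullback_def
proof (intro conjI allI impI)
  show "commuting_square set_cat (set_arrow A f D) (set_arrow B g D) (set_arrow P p A) (set_arrow P q B)"
    using assms by (auto simp: commuting_square_def)
  fix p' q' assume sq': "commuting_square set_cat (set_arrow A f D) (set_arrow B g D) p' q'"
  then have ar: "p' \<in> Ar set_cat" "q' \<in> Ar set_cat" "src p' = src q'" "tgt p' = A" "tgt q' = B"
    by (auto simp: commuting_square_def)
  define Z where "Z = src p'"
  have "p' \<in> Hom set_cat Z A" "q' \<in> Hom set_cat Z B"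
    using ar by (simp_all add: Hom_def Z_def)
  then obtain u v where u: "p' = set_arrow Z u A" "u \<in> Z \<rightarrow> A" "small Z"
    and v: "q' = set_arrow Z v B" "v \<in> Z \<rightarrow> B"
    by (metis set_HomE)
  have uv: "f (u z) = g (v z)" if "z \<in> Z" for z
    using sq' u v that by (auto simp: commuting_square_def)
  have "\<forall>z\<in>Z. \<exists>w. w \<in> P \<and> p w = u z \<and> q w = v z"
    using ex1 uv u(2) v(2) by blast
  then obtain h where h: "\<And>z. z \<in> Z \<Longrightarrow> h z \<in> P \<and> p (h z) = u z \<and> q (h z) = v z"
    by metis
  show "\<exists>!h. h \<in> Hom set_cat (Dom set_cat p') (Dom set_cat (set_arrow P p A)) \<and>
      Cmp set_cat (set_arrow P p A) h = p' \<and> Cmp set_cat (set_arrow P q B) h = q'"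
  proof (rule ex1I[of _ "set_arrow Z h P"])
    show "set_arrow Z h P \<in> Hom set_cat (Dom set_cat p') (Dom set_cat (set_arrow P p A)) \<and>
      Cmp set_cat (set_arrow P p A) (set_arrow Z h P) = p' \<and>
      Cmp set_cat (set_arrow P q B) (set_arrow Z h P) = q'"
      using h u v assms by (auto simp: set_Cmp Pi_iff)
  next
    fix k assume k: "k \<in> Hom set_cat (Dom set_cat p') (Dom set_cat (set_arrow P p A)) \<and>
      Cmp set_cat (set_arrow P p A) k = p' \<and> Cmp set_cat (set_arrow P q B) k = q'"
    then obtain l where l: "k = set_arrow Z l P" "l \<in> Z \<rightarrow> P"
      using u by (auto elim!: set_HomE)
    have "p (l z) = u z" "q (l z) = v z" if "z \<in> Z" for z
      using k l that unfolding u v by auto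
    then have "h z = l z" if "z \<in> Z" for z
      using ex1[of "u z" "v z"] h[OF that] that u v uv l by (metis PiE)
    then show "k = set_arrow Z h P"
      using l by simp
  qed
qed

section \<open>Coalgebras and their pullbacks\<close>

lemma coalg_category:
  assumes "cat_functor C C F"
  shows "category (coalg_cat C F)"
proof -
  interpret F: cat_functor C C F
    by (rule assms)
  have Homs: "h \<in> Hom (coalg_cat C F) X Y \<longleftrightarrow>
    (\<exists>A \<alpha> B \<beta> \<phi>. X = (A, \<alpha>) \<and> Y = (B, \<beta>) \<and> h = Arrow X \<phi> Y \<and> A \<in> Ob C \<and> B \<in> Ob C \<and>
      \<alpha> \<in> Hom C A (onOb F A) \<and> \<beta> \<in> Hom C B (onOb F B) \<and> \<phi> \<in> Hom C A B \<and>
      Cmp C \<beta> \<phi> = Cmp C (onAr F \<phi>) \<alpha>)" for h X Y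
    by (auto simp: Hom_def coalg_cat_def Let_def)
  have Cmps: "Cmp (coalg_cat C F) (Arrow Y \<psi> Z) (Arrow X \<phi> Y) = Arrow X (Cmp C \<psi> \<phi>) Z" for X Y Z \<phi> \<psi>
    by (simp add: coalg_cat_def Let_def)
  have Ides: "Ide (coalg_cat C F) (A, \<alpha>) = Arrow (A, \<alpha>) (Ide C A) (A, \<alpha>)" for A \<alpha>
    by (simp add: coalg_cat_def Let_def)
  show ?thesis
  proof
    fix f assume "f \<in> Ar (coalg_cat C F)"
    then show "Dom (coalg_cat C F) f \<in> Ob (coalg_cat C F)" "Cod (coalg_cat C F) f \<in> Ob (coalg_cat C F)"
      by (auto simp: coalg_cat_def Let_def)
  next
    fix X assume "X \<in> Ob (coalg_cat C F)"
    then obtain A \<alpha> where X: "X = (A, \<alpha>)" "A \<in> Ob C" "\<alpha> \<in> Hom C A (onOb F A)"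
      by (auto simp: coalg_cat_def Let_def)
    then show "Ide (coalg_cat C F) X \<in> Hom (coalg_cat C F) X X"
      using F.C.Cmp_Ide[OF X(3)] F.C.Ide_Cmp[OF X(3)] F.onAr_Ide F.C.Ide_in by (simp add: Homs Ides)
  next
    fix f X Y assume "f \<in> Hom (coalg_cat C F) X Y"
    then show "Cmp (coalg_cat C F) f (Ide (coalg_cat C F) X) = f"
      "Cmp (coalg_cat C F) (Ide (coalg_cat C F) Y) f = f"
      using F.C.Cmp_Ide F.C.Ide_Cmp by (auto simp: Homs Ides Cmps)
  next
    fix f W X g Y h Z
    assume "f \<in> Hom (coalg_cat C F) W X" "g \<in> Hom (coalg_cat C F) X Y" "h \<in> Hom (coalg_cat C F) Y Z"
    then show "Cmp (coalg_cat C F) (Cmp (coalg_cat C F) h g) f =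
        Cmp (coalg_cat C F) h (Cmp (coalg_cat C F) g f)"
      using F.C.Cmp_assoc by (auto simp: Homs Cmps)
  next
    fix f X Y g Z
    assume f: "f \<in> Hom (coalg_cat C F) X Y" and g: "g \<in> Hom (coalg_cat C F) Y Z"
    obtain A \<alpha> B \<beta> \<phi> where X: "X = (A, \<alpha>)" "Y = (B, \<beta>)" "f = Arrow X \<phi> Y" "A \<in> Ob C" "B \<in> Ob C"
      "\<alpha> \<in> Hom C A (onOb F A)" "\<beta> \<in> Hom C B (onOb F B)" "\<phi> \<in> Hom C A B"
      "Cmp C \<beta> \<phi> = Cmp C (onAr F \<phi>) \<alpha>"
      using f by (auto simp: Homs)
    obtain D \<delta> \<psi> where Z: "Z = (D, \<delta>)" "g = Arrow Y \<psi> Z" "D \<in> Ob C"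
      "\<delta> \<in> Hom C D (onOb F D)" "\<psi> \<in> Hom C B D" "Cmp C \<delta> \<psi> = Cmp C (onAr F \<psi>) \<beta>"
      using g X by (auto simp: Homs)
    note F\<phi> = F.onAr_in[OF X(8)] and F\<psi> = F.onAr_in[OF Z(5)]
    have "Cmp C \<delta> (Cmp C \<psi> \<phi>) = Cmp C (Cmp C \<delta> \<psi>) \<phi>"
      using F.C.Cmp_assoc[OF X(8) Z(5,4)] by simp
    also have "\<dots> = Cmp C (onAr F \<psi>) (Cmp C \<beta> \<phi>)"
      using F.C.Cmp_assoc[OF X(8,7) F\<psi>] by (simp add: Z(6))
    also have "\<dots> = Cmp C (onAr F (Cmp C \<psi> \<phi>)) \<alpha>"
      using F.C.Cmp_assoc[OF X(6) F\<phi> F\<psi>] F.onAr_Cmp[OF X(8) Z(5)] by (simp add: X(9))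
    finally have "Cmp C \<delta> (Cmp C \<psi> \<phi>) = Cmp C (onAr F (Cmp C \<psi> \<phi>)) \<alpha>" .
    then show "Cmp (coalg_cat C F) g f \<in> Hom (coalg_cat C F) X Z"
      using X Z F.C.Cmp_in[OF X(8) Z(5)] by (simp add: Homs Cmps)
  qed
qed

locale wpb_endofunctor = set_universe U + cat_functor set_cat set_cat F
  for U :: "'u itself" and F :: "'u set_endo" +
  assumes wpb: "weakly_preserves_pullbacks set_cat set_cat F"
begin

text \<open>
  The action of \<open>F\<close> on maps as a bare function, so that equations between arrows become equations
  between values at elements.
\<close>

definition Fm :: "'u set \<Rightarrow> 'u set \<Rightarrow> ('u \<Rightarrow> 'u) \<Rightarrow> 'u \<Rightarrow> 'u" where
  "Fm A B f = under (onAr F (set_arrow A f B))"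

lemma FO_small: "small A \<Longrightarrow> small (onOb F A)"
  using onOb_in by simp

lemma
  assumes "small A" "small B" "f \<in> A \<rightarrow> B"
  shows onAr_set_arrow: "onAr F (set_arrow A f B) = set_arrow (onOb F A) (Fm A B f) (onOb F B)"
    and Fm_in: "Fm A B f \<in> onOb F A \<rightarrow> onOb F B"
proof -
  have "onAr F (set_arrow A f B) \<in> Hom set_cat (onOb F A) (onOb F B)"
    using assms by (intro onAr_in) simp
  then obtain k where k: "onAr F (set_arrow A f B) = set_arrow (onOb F A) k (onOb F B)"
    "k \<in> onOb F A \<rightarrow> onOb F B"
    by (rule set_HomE)
  then show "onAr F (set_arrow A f B) = set_arrow (onOb F A) (Fm A B f) (onOb F B)"
    "Fm A B f \<in> onOb F A \<rightarrow> onOb F B"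
    by (auto simp: Fm_def)
qed

lemma Fm_cong: "(\<And>x. x \<in> A \<Longrightarrow> f x = g x) \<Longrightarrow> Fm A B f = Fm A B g"
  unfolding Fm_def by (metis set_arrow_eq)

lemma Fm_id: "small A \<Longrightarrow> u \<in> onOb F A \<Longrightarrow> Fm A A (\<lambda>x. x) u = u"
  using onAr_Ide[of A] onAr_set_arrow[of A A "\<lambda>x. x"] by auto

lemma Fm_comp:
  assumes "small A" "small B" "small D" "f \<in> A \<rightarrow> B" "g \<in> B \<rightarrow> D" "u \<in> onOb F A"
  shows "Fm B D g (Fm A B f u) = Fm A D (g \<circ> f) u"
proof -
  have "onAr F (Cmp set_cat (set_arrow B g D) (set_arrow A f B)) =
      Cmp set_cat (onAr F (set_arrow B g D)) (onAr F (set_arrow A f B))"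
    by (rule onAr_Cmp[where X = A and Y = B and Z = D]) (use assms in auto)
  moreover have gf: "g \<circ> f \<in> A \<rightarrow> D"
    using assms by auto
  ultimately have "\<forall>u\<in>onOb F A. Fm A D (g \<circ> f) u = (Fm B D g \<circ> Fm A B f) u"
    using assms by (simp add: onAr_set_arrow[OF _ _ gf] onAr_set_arrow Fm_in del: comp_apply)
  then show ?thesis
    using assms by simp
qed

text \<open>
  Weak preservation, read elementwise: test the weak pullback against a one-element set.
\<close>

lemma Fm_weak_pullback:
  assumes "small A" "small B" "small D" "small P"
    and f: "f \<in> A \<rightarrow> D" and g: "g \<in> B \<rightarrow> D" and p: "p \<in> P \<rightarrow> A" and q: "q \<in> P \<rightarrow> B"
    and sq: "\<And>w. w \<in> P \<Longrightarrow> f (p w) = g (q w)"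
    and ex1: "\<And>a b. a \<in> A \<Longrightarrow> b \<in> B \<Longrightarrow> f a = g b \<Longrightarrow> \<exists>!w. w \<in> P \<and> p w = a \<and> q w = b"
    and u: "u \<in> onOb F A" and v: "v \<in> onOb F B" and uv: "Fm A D f u = Fm B D g v"
  shows "\<exists>w\<in>onOb F P. Fm P A p w = u \<and> Fm P B q w = v"
proof -
  have "weak_pullback set_cat (onAr F (set_arrow A f D)) (onAr F (set_arrow B g D))
      (onAr F (set_arrow P p A)) (onAr F (set_arrow P q B))"
    using set_pullbackI[OF assms(1-10)] wpb unfolding weakly_preserves_pullbacks_def by blast
  then have wp: "weak_pullback set_cat (set_arrow (onOb F A) (Fm A D f) (onOb F D))
      (set_arrow (onOb F B) (Fm B D g) (onOb F D))
      (set_arrow (onOb F P) (Fm P A p) (onOb F A)) (set_arrow (onOb F P) (Fm P B q) (onOb F B))"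
    using assms by (simp add: onAr_set_arrow)
  have s: "small {u}"
    by (simp add: small_iff_tiny tiny_finite)
  have "commuting_square set_cat (set_arrow (onOb F A) (Fm A D f) (onOb F D))
      (set_arrow (onOb F B) (Fm B D g) (onOb F D))
      (set_arrow {u} (\<lambda>_. u) (onOb F A)) (set_arrow {u} (\<lambda>_. v) (onOb F B))"
    using assms s by (simp add: commuting_square_def Fm_in FO_small)
  then obtain h where h: "h \<in> Hom set_cat {u} (onOb F P)"
    "Cmp set_cat (set_arrow (onOb F P) (Fm P A p) (onOb F A)) h = set_arrow {u} (\<lambda>_. u) (onOb F A)"
    "Cmp set_cat (set_arrow (onOb F P) (Fm P B q) (onOb F B)) h = set_arrow {u} (\<lambda>_. v) (onOb F B)"
    using wp unfolding weak_pullback_def by fastforce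
  then obtain k where "h = set_arrow {u} k (onOb F P)" "k \<in> {u} \<rightarrow> onOb F P"
    by (auto elim: set_HomE)
  then show ?thesis
    using h by (intro bexI[of _ "k u"]) auto
qed

text \<open>
  An injective map has the identities as its kernel pair, and this pullback is weakly preserved.
\<close>

lemma Fm_inj:
  assumes A: "small A" "small B" and m: "m \<in> A \<rightarrow> B" "inj_on m A"
  shows "inj_on (Fm A B m) (onOb F A)"
proof (rule inj_onI)
  fix u v assume uv: "u \<in> onOb F A" "v \<in> onOb F A" "Fm A B m u = Fm A B m v"
  have "\<exists>w\<in>onOb F A. Fm A A (\<lambda>x. x) w = u \<and> Fm A A (\<lambda>x. x) w = v"
    by (rule Fm_weak_pullback[where f = m and g = m and D = B]) (use A m uv in \<open>auto dest: inj_onD\<close>)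
  then show "u = v"
    using Fm_id[OF A(1)] by auto
qed

definition str :: "'u set \<times> 'u smap \<Rightarrow> 'u \<Rightarrow> 'u" where
  "str X = under (snd X)"

definition coalg :: "'u set \<Rightarrow> ('u \<Rightarrow> 'u) \<Rightarrow> 'u set \<times> 'u smap" where
  "coalg A \<alpha> = (A, set_arrow A \<alpha> (onOb F A))"

abbreviation "Coalg \<equiv> Ob (Set_coalg F)"

lemma coalg_in: "small A \<Longrightarrow> \<alpha> \<in> A \<rightarrow> onOb F A \<Longrightarrow> coalg A \<alpha> \<in> Coalg"
  by (simp add: coalg_def coalg_cat_def Let_def FO_small)

lemma fst_coalg [simp]: "fst (coalg A \<alpha>) = A"
  by (simp add: coalg_def)

lemma str_coalg [simp]: "x \<in> A \<Longrightarrow> str (coalg A \<alpha>) x = \<alpha> x"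
  by (simp add: coalg_def str_def)

lemma CoalgD:
  assumes "X \<in> Coalg"
  shows "small (fst X)" "str X \<in> fst X \<rightarrow> onOb F (fst X)"
    "snd X = set_arrow (fst X) (str X) (onOb F (fst X))" "X = coalg (fst X) (str X)"
proof -
  obtain A \<alpha> where X: "X = (A, \<alpha>)" "small A" "\<alpha> \<in> Hom set_cat A (onOb F A)"
    using assms by (auto simp: coalg_cat_def Let_def)
  moreover obtain k where "\<alpha> = set_arrow A k (onOb F A)" "k \<in> A \<rightarrow> onOb F A"
    using X(3) by (rule set_HomE)
  ultimately show "small (fst X)" "str X \<in> fst X \<rightarrow> onOb F (fst X)"
    "snd X = set_arrow (fst X) (str X) (onOb F (fst X))" "X = coalg (fst X) (str X)"
    by (auto simp: str_def coalg_def)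
qed

lemma str_in: "X \<in> Coalg \<Longrightarrow> x \<in> fst X \<Longrightarrow> str X x \<in> onOb F (fst X)"
  using CoalgD(2) by blast

definition hom :: "'u set \<times> 'u smap \<Rightarrow> 'u set \<times> 'u smap \<Rightarrow> ('u \<Rightarrow> 'u) \<Rightarrow> bool" where
  "hom X Y f \<longleftrightarrow> f \<in> fst X \<rightarrow> fst Y \<and> (\<forall>x\<in>fst X. Fm (fst X) (fst Y) f (str X x) = str Y (f x))"

definition arr where
  "arr X f Y = Arrow X (set_arrow (fst X) f (fst Y)) Y"

lemma arr_sel [simp]: "src (arr X f Y) = X" "tgt (arr X f Y) = Y"
  by (simp_all add: arr_def)

lemma coalg_Dom_Cod [simp]: "Dom (Set_coalg F) = src" "Cod (Set_coalg F) = tgt"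
  by (simp_all add: coalg_cat_def Let_def)

lemma square_iff_hom:
  assumes X: "X \<in> Coalg" and Y: "Y \<in> Coalg" and f: "f \<in> fst X \<rightarrow> fst Y"
  shows "Cmp set_cat (snd Y) (set_arrow (fst X) f (fst Y)) =
      Cmp set_cat (onAr F (set_arrow (fst X) f (fst Y))) (snd X) \<longleftrightarrow> hom X Y f"
  unfolding CoalgD(3)[OF X] CoalgD(3)[OF Y] onAr_set_arrow[OF CoalgD(1)[OF X] CoalgD(1)[OF Y] f]
    set_Cmp[OF f] set_Cmp[OF CoalgD(2)[OF X]] set_arrow_eq
  using f by (auto simp: hom_def)

lemma arr_in_Hom [simp]:
  "arr X f Y \<in> Hom (Set_coalg F) X' Y' \<longleftrightarrow> X' = X \<and> Y' = Y \<and> X \<in> Coalg \<and> Y \<in> Coalg \<and> hom X Y f"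
proof -
  have ob: "X \<in> Coalg \<longleftrightarrow> small (fst X) \<and> snd X \<in> Hom set_cat (fst X) (onOb F (fst X))" for X
    by (cases X) (simp add: coalg_cat_def Let_def)
  have "arr X f Y \<in> Ar (Set_coalg F) \<longleftrightarrow> X \<in> Coalg \<and> Y \<in> Coalg \<and> f \<in> fst X \<rightarrow> fst Y \<and>
     Cmp set_cat (snd Y) (set_arrow (fst X) f (fst Y)) =
      Cmp set_cat (onAr F (set_arrow (fst X) f (fst Y))) (snd X)"
    unfolding ob by (cases X; cases Y) (auto simp: coalg_cat_def Let_def arr_def)
  then show ?thesis
    using square_iff_hom[of X Y f] by (auto simp: Hom_def hom_def)
qed

lemma arr_in_Ar [simp]: "arr X f Y \<in> Ar (Set_coalg F) \<longleftrightarrow> X \<in> Coalg \<and> Y \<in> Coalg \<and> hom X Y f"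
  using arr_in_Hom[of X f Y X Y] by (simp add: Hom_def)

lemma coalg_HomE:
  assumes "h \<in> Hom (Set_coalg F) X Y"
  obtains f where "h = arr X f Y" "X \<in> Coalg" "Y \<in> Coalg" "hom X Y f"
proof -
  obtain k where k: "h = Arrow X k Y" "k \<in> Hom set_cat (fst X) (fst Y)"
    using assms by (auto simp: Hom_def coalg_cat_def Let_def)
  obtain f where "k = set_arrow (fst X) f (fst Y)"
    using k(2) by (rule set_HomE)
  then have h: "h = arr X f Y"
    using k by (simp add: arr_def)
  show ?thesis
    using that[OF h] assms[unfolded h] by simp
qed

lemma coalg_ArE:
  assumes "h \<in> Ar (Set_coalg F)"
  obtains X f Y where "h = arr X f Y" "X \<in> Coalg" "Y \<in> Coalg" "hom X Y f"
proof -
  have "h \<in> Hom (Set_coalg F) (src h) (tgt h)"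
    using assms by (simp add: Hom_def)
  then show ?thesis
    by (rule coalg_HomE) (rule that)
qed

lemma arr_eq [simp]: "arr X f Y = arr X g Y \<longleftrightarrow> (\<forall>x\<in>fst X. f x = g x)"
  by (simp add: arr_def)

lemma hom_fun: "hom X Y f \<Longrightarrow> x \<in> fst X \<Longrightarrow> f x \<in> fst Y"
  by (auto simp: hom_def)

lemma coalg_Cmp [simp]:
  assumes "hom X Y f"
  shows "Cmp (Set_coalg F) (arr Y g Z) (arr X f Y) = arr X (g \<circ> f) Z"
  using assms by (simp add: coalg_cat_def Let_def arr_def hom_def)

lemma hom_cong: "hom X Y f \<Longrightarrow> (\<And>x. x \<in> fst X \<Longrightarrow> f x = g x) \<Longrightarrow> hom X Y g"
  using Fm_cong[of "fst X" f g "fst Y"] by (auto simp: hom_def Pi_iff)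

lemma hom_id: "X \<in> Coalg \<Longrightarrow> hom X X (\<lambda>x. x)"
  using CoalgD by (auto simp: hom_def Fm_id Pi_iff)

lemma hom_comp:
  assumes ob: "X \<in> Coalg" "Y \<in> Coalg" "Z \<in> Coalg" and f: "hom X Y f" and g: "hom Y Z g"
  shows "hom X Z (g \<circ> f)"
  unfolding hom_def
proof (intro conjI ballI)
  show "g \<circ> f \<in> fst X \<rightarrow> fst Z"
    using f g by (auto simp: hom_def)
  fix x assume x: "x \<in> fst X"
  have "Fm (fst X) (fst Z) (g \<circ> f) (str X x) = Fm (fst Y) (fst Z) g (Fm (fst X) (fst Y) f (str X x))"
    by (rule Fm_comp[symmetric]) (use ob f g x CoalgD(1) str_in in \<open>auto simp: hom_def\<close>)
  also have "\<dots> = str Z ((g \<circ> f) x)"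
    using f g x by (auto simp: hom_def)
  finally show "Fm (fst X) (fst Z) (g \<circ> f) (str X x) = str Z ((g \<circ> f) x)" .
qed

text \<open>
  Since \<open>F m\<close> is injective, the homomorphism equation for \<open>f\<close> may be tested after applying \<open>F m\<close>.
\<close>

lemma hom_through_mono:
  assumes ob: "X \<in> Coalg" "Y \<in> Coalg" "Z \<in> Coalg" and m: "hom Y Z m" "inj_on m (fst Y)"
    and f: "f \<in> fst X \<rightarrow> fst Y" "hom X Z (m \<circ> f)"
  shows "hom X Y f"
  unfolding hom_def
proof (intro conjI ballI f(1))
  fix x assume x: "x \<in> fst X"
  note s = CoalgD(1)[OF ob(1)] CoalgD(1)[OF ob(2)] CoalgD(1)[OF ob(3)]
  have mf: "m \<in> fst Y \<rightarrow> fst Z"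
    using m(1) by (simp add: hom_def)
  have sx: "str X x \<in> onOb F (fst X)" and sy: "str Y (f x) \<in> onOb F (fst Y)"
    using CoalgD(2) ob x f(1) by blast+
  have "Fm (fst Y) (fst Z) m (Fm (fst X) (fst Y) f (str X x)) = Fm (fst X) (fst Z) (m \<circ> f) (str X x)"
    by (rule Fm_comp) (use s mf f(1) sx in auto)
  also have "\<dots> = Fm (fst Y) (fst Z) m (str Y (f x))"
    using f m x by (auto simp: hom_def Pi_iff)
  finally show "Fm (fst X) (fst Y) f (str X x) = str Y (f x)"
    using Fm_inj[OF s(2,3) mf m(2)] Fm_in[OF s(1,2) f(1)] sx sy by (auto dest: inj_onD)
qed

text \<open>
  The homomorphism equation is a condition on single elements, so it may be checked after
  precomposition with morphisms which jointly cover the domain.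
\<close>

lemma hom_local:
  assumes ob: "X \<in> Coalg" "Y \<in> Coalg" and f: "f \<in> fst X \<rightarrow> fst Y"
    and cover: "\<And>x. x \<in> fst X \<Longrightarrow> \<exists>T e. T \<in> Coalg \<and> hom T X e \<and> x \<in> e ` fst T \<and> hom T Y (f \<circ> e)"
  shows "hom X Y f"
  unfolding hom_def
proof (intro conjI ballI f)
  fix x assume "x \<in> fst X"
  then obtain T e t where T: "T \<in> Coalg" and e: "hom T X e" and fe: "hom T Y (f \<circ> e)"
    and t: "t \<in> fst T" "x = e t"
    using cover by blast
  have "Fm (fst X) (fst Y) f (Fm (fst T) (fst X) e (str T t)) = Fm (fst T) (fst Y) (f \<circ> e) (str T t)"
    by (rule Fm_comp) (use ob T CoalgD(1) str_in t e f in \<open>auto simp: hom_def\<close>)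
  then show "Fm (fst X) (fst Y) f (str X x) = str Y (f x)"
    using t e fe by (simp add: hom_def)
qed

text \<open>
  The structure map on such a \<open>T\<close> is not unique, and \<open>T\<close> need not be a pullback of coalgebras. Only
  the underlying square of sets is required to be one.
\<close>

definition hom_pullback where
  "hom_pullback X Y f g T p q \<longleftrightarrow> T \<in> Coalg \<and> hom T X p \<and> hom T Y q \<and>
     (\<forall>t\<in>fst T. f (p t) = g (q t)) \<and>
     (\<forall>x\<in>fst X. \<forall>y\<in>fst Y. f x = g y \<longrightarrow> (\<exists>!t. t \<in> fst T \<and> p t = x \<and> q t = y))"

lemma hom_pullbackD:
  assumes "hom_pullback X Y f g T p q"
  shows "T \<in> Coalg" "hom T X p" "hom T Y q" "t \<in> fst T \<Longrightarrow> f (p t) = g (q t)"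
    "x \<in> fst X \<Longrightarrow> y \<in> fst Y \<Longrightarrow> f x = g y \<Longrightarrow> \<exists>!t. t \<in> fst T \<and> p t = x \<and> q t = y"
  using assms by (auto simp: hom_pullback_def)

text \<open>
  At a pair \<open>(x, y)\<close> with \<open>f x = g y\<close>, the values of the two structure maps have the same image in
  \<open>F Z\<close>. Weak preservation of the pullback supplies a common preimage, and any choice of such
  preimages is a structure map.
\<close>

lemma hom_pullback_ex:
  assumes ob: "X \<in> Coalg" "Y \<in> Coalg" "Z \<in> Coalg" and f: "hom X Z f" and g: "hom Y Z g"
  obtains T p q where "hom_pullback X Y f g T p q"
proof -
  note s = CoalgD(1)[OF ob(1)] CoalgD(1)[OF ob(2)] CoalgD(1)[OF ob(3)]
  let ?R = "{(x, y) \<in> fst X \<times> fst Y. f x = g y}"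
  have "tiny ?R"
    using s by (intro tiny_subset[OF tiny_Sigma[of "fst X" "\<lambda>_. fst Y"]]) (auto simp: small_iff_tiny)
  then obtain e :: "'u \<times> 'u \<Rightarrow> 'u" where e: "inj_on e ?R" "small (e ` ?R)"
    by (rule tiny_encode)
  define P where "P = e ` ?R"
  define p where "p t = fst (inv_into ?R e t)" for t
  define q where "q t = snd (inv_into ?R e t)" for t
  have inv: "p (e (x, y)) = x" "q (e (x, y)) = y" "e (x, y) \<in> P"
    if "x \<in> fst X" "y \<in> fst Y" "f x = g y" for x y
    using that e(1) by (auto simp: p_def q_def P_def)
  have P: "p t \<in> fst X \<and> q t \<in> fst Y \<and> f (p t) = g (q t) \<and> t = e (p t, q t)" if "t \<in> P" for t
    using that e(1) by (auto simp: p_def q_def P_def)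
  have ex1: "\<exists>!t. t \<in> P \<and> p t = x \<and> q t = y" if "x \<in> fst X" "y \<in> fst Y" "f x = g y" for x y
    using P inv[OF that] by metis
  have maps: "f \<in> fst X \<rightarrow> fst Z" "g \<in> fst Y \<rightarrow> fst Z" "p \<in> P \<rightarrow> fst X" "q \<in> P \<rightarrow> fst Y"
    using f g P by (auto simp: hom_def)
  have sP: "small P"
    using e by (simp add: P_def)
  have "\<exists>w\<in>onOb F P. Fm P (fst X) p w = str X (p t) \<and> Fm P (fst Y) q w = str Y (q t)"
    if t: "t \<in> P" for t
    by (rule Fm_weak_pullback[where f = f and g = g and D = "fst Z"])
      (use s sP maps P ex1 t f g str_in[OF ob(1)] str_in[OF ob(2)] in \<open>auto simp: hom_def\<close>)
  then obtain \<gamma> where \<gamma>: "\<And>t. t \<in> P \<Longrightarrow> \<gamma> t \<in> onOb F P \<and>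
      Fm P (fst X) p (\<gamma> t) = str X (p t) \<and> Fm P (fst Y) q (\<gamma> t) = str Y (q t)"
    by metis
  have "coalg P \<gamma> \<in> Coalg"
    using sP \<gamma> by (intro coalg_in) auto
  moreover have "hom (coalg P \<gamma>) X p" "hom (coalg P \<gamma>) Y q"
    using \<gamma> maps by (auto simp: hom_def)
  ultimately show ?thesis
    using P ex1 by (intro that[of "coalg P \<gamma>" p q]) (simp add: hom_pullback_def)
qed

text \<open>
  The projections of a kernel pair become equal after composition with the morphism, so they are equal
  if it is monic.
\<close>

lemma monic_inj:
  assumes ob: "X \<in> Coalg" "Y \<in> Coalg" and m: "monic (Set_coalg F) (arr X m Y)"
  shows "inj_on m (fst X)"
proof (rule inj_onI)
  have hm: "hom X Y m"
    using m by (simp add: monic_def)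
  fix x y assume xy: "x \<in> fst X" "y \<in> fst X" "m x = m y"
  obtain T p q where pb: "hom_pullback X X m m T p q"
    by (rule hom_pullback_ex[OF ob(1,1,2) hm hm])
  note T = hom_pullbackD(1-3)[OF pb] and sq = hom_pullbackD(4)[OF pb] and ex1 = hom_pullbackD(5)[OF pb]
  have "arr T p X \<in> Hom (Set_coalg F) T X" "arr T q X \<in> Hom (Set_coalg F) T X"
    using T ob by auto
  moreover have "Cmp (Set_coalg F) (arr X m Y) (arr T p X) = Cmp (Set_coalg F) (arr X m Y) (arr T q X)"
    using T sq by simp
  moreover have "Dom (Set_coalg F) (arr X m Y) = X"
    by simp
  ultimately have "arr T p X = arr T q X"
    using m T(1) unfolding monic_def by metis
  then show "x = y"
    using ex1[OF xy] by auto
qed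

text \<open>
  The projection opposite to an injective map is injective, so mediating maps are morphisms by
  \<open>hom_through_mono\<close>.
\<close>

lemma monic_pullback:
  assumes f: "f \<in> Ar (Set_coalg F)" and m: "monic (Set_coalg F) m"
    and c: "Cod (Set_coalg F) f = Cod (Set_coalg F) m"
  shows "\<exists>q r. pullback (Set_coalg F) f m q r"
proof -
  obtain X k Z where fk: "f = arr X k Z" and ob: "X \<in> Coalg" "Z \<in> Coalg" and k: "hom X Z k"
    using f by (rule coalg_ArE)
  have "m \<in> Ar (Set_coalg F)"
    using m by (simp add: monic_def)
  then obtain Y l Z' where "m = arr Y l Z'" "Y \<in> Coalg" "hom Y Z' l"
    by (rule coalg_ArE)
  then have ml: "m = arr Y l Z" and Y: "Y \<in> Coalg" and l: "hom Y Z l"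
    using c fk by auto
  have inj: "inj_on l (fst Y)"
    using monic_inj[OF Y ob(2)] m ml by simp
  obtain T p q where pb: "hom_pullback X Y k l T p q"
    by (rule hom_pullback_ex[OF ob(1) Y ob(2) k l])
  note T = hom_pullbackD(1)[OF pb] and p = hom_pullbackD(2)[OF pb] and q = hom_pullbackD(3)[OF pb]
    and sq = hom_pullbackD(4)[OF pb] and ex1 = hom_pullbackD(5)[OF pb]
  have pinj: "inj_on p (fst T)"
  proof (rule inj_onI)
    fix s t assume st: "s \<in> fst T" "t \<in> fst T" "p s = p t"
    then have "l (q s) = l (q t)"
      using sq by metis
    then have "q s = q t"
      using inj st hom_fun[OF q] by (auto dest: inj_onD)
    then show "s = t"
      using ex1[OF hom_fun[OF p st(1)] hom_fun[OF q st(1)] sq[OF st(1)]] st by metis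
  qed
  have "pullback (Set_coalg F) f m (arr T p X) (arr T q Y)"
    unfolding pullback_def
  proof (intro conjI allI impI)
    show "commuting_square (Set_coalg F) f m (arr T p X) (arr T q Y)"
      using ob Y T k l p q sq by (simp add: commuting_square_def fk ml)
    fix p' q' assume sq': "commuting_square (Set_coalg F) f m p' q'"
    then have "p' \<in> Ar (Set_coalg F)"
      by (simp add: commuting_square_def)
    then obtain W a X' where "p' = arr W a X'" "W \<in> Coalg" "hom W X' a"
      by (rule coalg_ArE)
    then have a: "p' = arr W a X" "W \<in> Coalg" "hom W X a"
      using sq' by (auto simp: commuting_square_def fk)
    have "q' \<in> Ar (Set_coalg F)"
      using sq' by (simp add: commuting_square_def)
    then obtain W' b Y' where "q' = arr W' b Y'" "hom W' Y' b"
      by (rule coalg_ArE)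
    then have b: "q' = arr W b Y" "hom W Y b"
      using sq' a by (auto simp: commuting_square_def ml)
    have ab: "k (a w) = l (b w)" if "w \<in> fst W" for w
      using sq' a b that by (simp add: commuting_square_def fk ml)
    have "\<forall>w\<in>fst W. \<exists>t. t \<in> fst T \<and> p t = a w \<and> q t = b w"
      using ex1 ab hom_fun[OF a(3)] hom_fun[OF b(2)] by blast
    then obtain h where h: "\<And>w. w \<in> fst W \<Longrightarrow> h w \<in> fst T \<and> p (h w) = a w \<and> q (h w) = b w"
      by metis
    have hh: "hom W T h"
    proof (rule hom_through_mono[OF a(2) T ob(1) p pinj])
      show "h \<in> fst W \<rightarrow> fst T"
        using h by auto
      show "hom W X (p \<circ> h)"
        using h by (intro hom_cong[OF a(3)]) auto
    qed
    show "\<exists>!h. h \<in> Hom (Set_coalg F) (Dom (Set_coalg F) p') (Dom (Set_coalg F) (arr T p X)) \<and>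
      Cmp (Set_coalg F) (arr T p X) h = p' \<and> Cmp (Set_coalg F) (arr T q Y) h = q'"
    proof (rule ex1I[of _ "arr W h T"])
      show "arr W h T \<in> Hom (Set_coalg F) (Dom (Set_coalg F) p') (Dom (Set_coalg F) (arr T p X)) \<and>
        Cmp (Set_coalg F) (arr T p X) (arr W h T) = p' \<and> Cmp (Set_coalg F) (arr T q Y) (arr W h T) = q'"
        using a b hh T h by simp
    next
      fix h' assume h': "h' \<in> Hom (Set_coalg F) (Dom (Set_coalg F) p') (Dom (Set_coalg F) (arr T p X)) \<and>
        Cmp (Set_coalg F) (arr T p X) h' = p' \<and> Cmp (Set_coalg F) (arr T q Y) h' = q'"
      then have "h' \<in> Hom (Set_coalg F) W T"
        using a by simp
      then obtain j where j: "h' = arr W j T" "hom W T j"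
        by (rule coalg_HomE)
      have "p (j w) = p (h w)" if "w \<in> fst W" for w
        using h' j a b h that by simp
      then have "j w = h w" if "w \<in> fst W" for w
        using that pinj h hom_fun[OF j(2)] by (metis inj_onD)
      then show "h' = arr W h T"
        using j by simp
    qed
  qed
  then show ?thesis
    by blast
qed

end

context wpb_endofunctor
begin

section \<open>Products of coalgebras\<close>

text \<open>
  Bisimilarity of elements by a span of coalgebras which respects the colourings \<open>k\<close> and \<open>l\<close>.
  A pair of morphisms \<open>f\<close>, \<open>g\<close> from a coalgebra is treated as the colouring
  \<open>x \<mapsto> (f x, g x)\<close>, so that a span respecting it is a span of coalgebras over \<open>X\<close> and \<open>Y\<close>.
\<close>

definition bisim ::
    "'u set \<times> 'u smap \<Rightarrow> ('u \<Rightarrow> 'c) \<Rightarrow> 'u \<Rightarrow> 'u set \<times> 'u smap \<Rightarrow> ('u \<Rightarrow> 'c) \<Rightarrow> 'u \<Rightarrow> bool" where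
  "bisim X k x Y l y \<longleftrightarrow> (\<exists>T a b. T \<in> Coalg \<and> hom T X a \<and> hom T Y b \<and>
     (\<forall>s\<in>fst T. k (a s) = l (b s)) \<and> (\<exists>t\<in>fst T. a t = x \<and> b t = y))"

lemma bisimI:
  assumes "T \<in> Coalg" "hom T X a" "hom T Y b" "\<And>s. s \<in> fst T \<Longrightarrow> k (a s) = l (b s)" "t \<in> fst T"
  shows "bisim X k (a t) Y l (b t)"
  unfolding bisim_def using assms by blast

lemma bisim_colour: "bisim X k x Y l y \<Longrightarrow> k x = l y"
  by (auto simp: bisim_def)

lemma bisim_sym: "bisim X k x Y l y \<Longrightarrow> bisim Y l y X k x"
  unfolding bisim_def by metis

lemma bisim_hom:
  assumes "X \<in> Coalg" "hom X Y f" "\<And>x. x \<in> fst X \<Longrightarrow> k x = l (f x)" "x \<in> fst X"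
  shows "bisim X k x Y l (f x)"
  using bisimI[OF assms(1) hom_id[OF assms(1)] assms(2), of k l] assms(3,4) by blast

lemma bisim_refl: "X \<in> Coalg \<Longrightarrow> x \<in> fst X \<Longrightarrow> bisim X k x X k x"
  using bisim_hom[of X X "\<lambda>x. x" k k x] hom_id by auto

text \<open>
  Compose the two spans by a pullback over \<open>Y\<close>. The colours on its two sides agree because they agree
  in the middle.
\<close>

lemma bisim_trans:
  assumes ob: "X \<in> Coalg" "Y \<in> Coalg" "Z \<in> Coalg"
    and xy: "bisim X k x Y l y" and yz: "bisim Y l y Z m z"
  shows "bisim X k x Z m z"
proof -
  obtain T a b t where T: "T \<in> Coalg" "hom T X a" "hom T Y b" "\<And>s. s \<in> fst T \<Longrightarrow> k (a s) = l (b s)"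
    "t \<in> fst T" "a t = x" "b t = y"
    using xy by (auto simp: bisim_def)
  obtain T' a' b' t' where T': "T' \<in> Coalg" "hom T' Y a'" "hom T' Z b'"
    "\<And>s. s \<in> fst T' \<Longrightarrow> l (a' s) = m (b' s)" "t' \<in> fst T'" "a' t' = y" "b' t' = z"
    using yz by (auto simp: bisim_def)
  obtain R p q where pb: "hom_pullback T T' b a' R p q"
    by (rule hom_pullback_ex[OF T(1) T'(1) ob(2) T(3) T'(2)])
  note R = hom_pullbackD[OF pb]
  obtain r where r: "r \<in> fst R" "p r = t" "q r = t'"
    using R(5)[OF T(5) T'(5)] T(7) T'(6) by auto
  have "bisim X k ((a \<circ> p) r) Z m ((b' \<circ> q) r)"
  proof (rule bisimI[OF R(1) _ _ _ r(1)])
    show "hom R X (a \<circ> p)" "hom R Z (b' \<circ> q)"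
      using hom_comp R T T' ob by blast+
    show "k ((a \<circ> p) s) = m ((b' \<circ> q) s)" if "s \<in> fst R" for s
      using T(4)[OF hom_fun[OF R(2) that]] T'(4)[OF hom_fun[OF R(3) that]] R(4)[OF that] by simp
  qed
  then show ?thesis
    using r T T' by simp
qed

text \<open>
  The quotient lives on a set of representatives. With \<open>\<omega>\<close> the structure map of \<open>W\<close>, the map
  \<open>F \<pi> \<circ> \<omega>\<close> takes equal values at bisimilar elements, which makes \<open>\<pi>\<close> a morphism: if
  \<open>v\<close> and \<open>w\<close> are linked by a span with legs \<open>a\<close> and \<open>b\<close>, then \<open>\<pi> \<circ> a = \<pi> \<circ> b\<close>, and both
  values equal the image under \<open>F (\<pi> \<circ> a)\<close> of one element.
\<close>

lemma bisim_quotient: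
  assumes W: "W \<in> Coalg"
  obtains P \<pi> where "P \<in> Coalg" "hom W P \<pi>" "\<pi> ` fst W = fst P"
    "\<forall>w\<in>fst W. k (\<pi> w) = k w"
    "\<forall>v\<in>fst W. \<forall>w\<in>fst W. \<pi> v = \<pi> w \<longleftrightarrow> bisim W k v W k w"
proof -
  let ?E = "\<lambda>v w. bisim W k v W k w"
  define \<pi> where "\<pi> w = (SOME v. v \<in> fst W \<and> ?E w v)" for w
  have \<pi>: "\<pi> w \<in> fst W \<and> ?E w (\<pi> w)" if "w \<in> fst W" for w
  proof -
    have "\<exists>v. v \<in> fst W \<and> ?E w v"
      using bisim_refl[OF W that] that by blast
    then show ?thesis
      unfolding \<pi>_def by (rule someI_ex)
  qed
  have iff: "\<pi> v = \<pi> w \<longleftrightarrow> ?E v w" if v: "v \<in> fst W" and w: "w \<in> fst W" for v w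
  proof
    assume "\<pi> v = \<pi> w"
    then show "?E v w"
      using \<pi>[OF v] \<pi>[OF w] bisim_trans[OF W W W] bisim_sym by metis
  next
    assume "?E v w"
    then have "?E v u \<longleftrightarrow> ?E w u" for u
      using bisim_trans[OF W W W] bisim_sym by metis
    then show "\<pi> v = \<pi> w"
      unfolding \<pi>_def by simp
  qed
  define P where "P = \<pi> ` fst W"
  have sP: "small P"
    using CoalgD(1)[OF W] tiny_image[of "fst W" \<pi>] by (simp add: P_def small_iff_tiny)
  have \<pi>P: "\<pi> \<in> fst W \<rightarrow> P"
    by (auto simp: P_def)
  have eq: "Fm (fst W) P \<pi> (str W v) = Fm (fst W) P \<pi> (str W w)" if vw: "?E v w" for v w
  proof -
    obtain T a b t where T: "T \<in> Coalg" "hom T W a" "hom T W b" "\<forall>s\<in>fst T. k (a s) = k (b s)"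
      "t \<in> fst T" "a t = v" "b t = w"
      using vw by (auto simp: bisim_def)
    have "?E (a s) (b s)" if "s \<in> fst T" for s
      using bisimI[OF T(1-3), of k k s] T(4) that by blast
    then have ab: "(\<pi> \<circ> a) s = (\<pi> \<circ> b) s" if "s \<in> fst T" for s
      using iff hom_fun T that by simp
    have F: "Fm (fst W) P \<pi> (str W (c t)) = Fm (fst T) P (\<pi> \<circ> c) (str T t)" if "hom T W c" for c
    proof -
      have "Fm (fst W) P \<pi> (Fm (fst T) (fst W) c (str T t)) = Fm (fst T) P (\<pi> \<circ> c) (str T t)"
        by (rule Fm_comp) (use CoalgD(1) T W sP \<pi>P str_in that in \<open>auto simp: hom_def\<close>)
      then show ?thesis
        using that T by (simp add: hom_def)
    qed
    have "Fm (fst T) P (\<pi> \<circ> a) = Fm (fst T) P (\<pi> \<circ> b)"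
      using ab by (rule Fm_cong)
    then show ?thesis
      using F[OF T(2)] F[OF T(3)] T by simp
  qed
  let ?P = "coalg P (\<lambda>p. Fm (fst W) P \<pi> (str W p))"
  have PW: "P \<subseteq> fst W"
    using \<pi> by (auto simp: P_def)
  have P: "?P \<in> Coalg"
    using Fm_in[OF CoalgD(1)[OF W] sP \<pi>P] str_in[OF W] PW sP by (intro coalg_in) auto
  moreover have "hom W ?P \<pi>"
    unfolding hom_def
  proof (intro conjI ballI)
    show "\<pi> \<in> fst W \<rightarrow> fst ?P"
      using \<pi>P by simp
    fix w assume w: "w \<in> fst W"
    then have "\<pi> w \<in> P"
      by (simp add: P_def)
    then show "Fm (fst W) (fst ?P) \<pi> (str W w) = str ?P (\<pi> w)"
      using eq \<pi>[OF w] by simp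
  qed
  moreover have "\<pi> ` fst W = fst ?P"
    by (simp add: P_def)
  moreover have "\<forall>w\<in>fst W. k (\<pi> w) = k w"
    using \<pi> bisim_colour by metis
  ultimately show ?thesis
    using iff by (intro that[of ?P \<pi>]) blast+
qed

text \<open>
  The disjoint union. Being covered by its components, it receives its structure from
  them.
\<close>

lemma coproduct_ex:
  fixes S :: "'i \<Rightarrow> 'u set \<times> 'u smap"
  assumes I: "tiny I" and S: "\<And>i. i \<in> I \<Longrightarrow> S i \<in> Coalg"
  obtains W \<iota> where "W \<in> Coalg" "\<forall>i\<in>I. hom (S i) W (\<iota> i)"
    "bij_betw (\<lambda>(i, s). \<iota> i s) (SIGMA i:I. fst (S i)) (fst W)"
proof -
  let ?B = "SIGMA i:I. fst (S i)"
  have "tiny ?B"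
    using I S CoalgD(1) by (intro tiny_Sigma) (auto simp flip: small_iff_tiny)
  then obtain e :: "'i \<times> 'u \<Rightarrow> 'u" where e: "inj_on e ?B" "small (e ` ?B)"
    by (rule tiny_encode)
  define W where "W = e ` ?B"
  define \<iota> where "\<iota> i s = e (i, s)" for i s
  define \<omega> where "\<omega> w = (case inv_into ?B e w of (i, s) \<Rightarrow> Fm (fst (S i)) W (\<iota> i) (str (S i) s))" for w
  have \<omega>: "\<omega> (\<iota> i s) = Fm (fst (S i)) W (\<iota> i) (str (S i) s)" if "i \<in> I" "s \<in> fst (S i)" for i s
    using e(1) that by (simp add: \<omega>_def \<iota>_def)
  have \<iota>: "\<iota> i \<in> fst (S i) \<rightarrow> W" if "i \<in> I" for i
    using that by (auto simp: \<iota>_def W_def)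
  have sW: "small W"
    using e by (simp add: W_def)
  have \<omega>W: "\<omega> \<in> W \<rightarrow> onOb F W"
  proof
    fix w assume "w \<in> W"
    then obtain i s where eq: "w = \<iota> i s" "i \<in> I" "s \<in> fst (S i)"
      by (auto simp: W_def \<iota>_def)
    then show "\<omega> w \<in> onOb F W"
      using Fm_in[OF CoalgD(1)[OF S] sW \<iota>] str_in[OF S] by (auto simp: \<omega>)
  qed
  show ?thesis
  proof (rule that[of "coalg W \<omega>" \<iota>])
    show "coalg W \<omega> \<in> Coalg"
      using sW \<omega>W by (rule coalg_in)
    show "\<forall>i\<in>I. hom (S i) (coalg W \<omega>) (\<iota> i)"
    proof
      fix i assume i: "i \<in> I"
      show "hom (S i) (coalg W \<omega>) (\<iota> i)"
        unfolding hom_def using \<iota>[OF i] \<omega>[OF i] by (auto simp: Pi_iff)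
    qed
    show "bij_betw (\<lambda>(i, s). \<iota> i s) ?B (fst (coalg W \<omega>))"
      using e(1) by (auto simp: bij_betw_def \<iota>_def W_def inj_on_def)
  qed
qed

lemma transport:
  assumes X: "X \<in> Coalg" and j: "inj_on j (fst X)"
  obtains Y where "Y \<in> Coalg" "fst Y = j ` fst X" "hom X Y j" "hom Y X (inv_into (fst X) j)"
proof -
  let ?A = "j ` fst X" and ?i = "inv_into (fst X) j"
  have s: "small (fst X)" "small ?A"
    using CoalgD(1)[OF X] tiny_image[of "fst X" j] by (simp_all add: small_iff_tiny)
  have jA: "j \<in> fst X \<rightarrow> ?A"
    by auto
  let ?Y = "coalg ?A (\<lambda>y. Fm (fst X) ?A j (str X (?i y)))"
  have "(\<lambda>y. Fm (fst X) ?A j (str X (?i y))) \<in> ?A \<rightarrow> onOb F ?A"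
    using Fm_in[OF s jA] str_in[OF X] j by (auto simp: Pi_iff)
  then have Y: "?Y \<in> Coalg"
    using s by (intro coalg_in)
  have h: "hom X ?Y j"
    using j by (auto simp: hom_def)
  have "hom ?Y X ?i"
  proof (rule hom_local[OF Y X])
    show "?i \<in> fst ?Y \<rightarrow> fst X"
      using j by auto
    fix y assume "y \<in> fst ?Y"
    moreover have "hom X X (?i \<circ> j)"
      using j by (intro hom_cong[OF hom_id[OF X]]) simp
    ultimately show "\<exists>T e. T \<in> Coalg \<and> hom T ?Y e \<and> y \<in> e ` fst T \<and> hom T X (?i \<circ> e)"
      using X h by (intro exI[of _ X] exI[of _ j]) simp
  qed
  then show ?thesis
    using that[OF Y _ h] by simp
qed

lemma subcoalgebraE:
  assumes "subcoalgebra F X S" "X \<in> Coalg"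
  obtains T where "T \<in> Coalg" "fst T = S" "hom T X (\<lambda>x. x)" "S \<subseteq> fst X"
proof -
  obtain \<sigma> where "Arrow (S, \<sigma>) (set_arrow S (\<lambda>x. x) (fst X)) X \<in> Ar (Set_coalg F)" and S: "S \<subseteq> fst X"
    using assms by (auto simp: subcoalgebra_def)
  then have "arr (S, \<sigma>) (\<lambda>x. x) X \<in> Ar (Set_coalg F)"
    by (simp add: arr_def)
  then show ?thesis
    using that[of "(S, \<sigma>)"] S by simp
qed

text \<open>
  Map \<open>z\<close> to the class of any \<open>w\<close> bisimilar to it. Along a span which links \<open>z\<close> to \<open>w\<close>, this
  map agrees with \<open>\<pi>\<close>, so it is a morphism by \<open>hom_local\<close>.
\<close>

lemma bisim_quotient_terminal:
  assumes W: "W \<in> Coalg" and P: "P \<in> Coalg" and \<pi>: "hom W P \<pi>"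
    and colour: "\<forall>w\<in>fst W. k (\<pi> w) = k w"
    and iff: "\<forall>v\<in>fst W. \<forall>w\<in>fst W. \<pi> v = \<pi> w \<longleftrightarrow> bisim W k v W k w"
    and Z: "Z \<in> Coalg" and cover: "\<And>z. z \<in> fst Z \<Longrightarrow> \<exists>w\<in>fst W. bisim Z l z W k w"
  shows "\<exists>h. hom Z P h \<and> (\<forall>z\<in>fst Z. k (h z) = l z)"
proof -
  obtain c where c: "\<And>z. z \<in> fst Z \<Longrightarrow> c z \<in> fst W \<and> bisim Z l z W k (c z)"
    using cover by metis
  define h where "h = \<pi> \<circ> c"
  have h: "h z = \<pi> w" if "z \<in> fst Z" "w \<in> fst W" "bisim Z l z W k w" for z w
    using iff c[OF that(1)] that(2) bisim_trans[OF W Z W bisim_sym] that(3) by (auto simp: h_def)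
  have "hom Z P h"
  proof (rule hom_local[OF Z P])
    show "h \<in> fst Z \<rightarrow> fst P"
      using c hom_fun[OF \<pi>] by (auto simp: h_def)
    fix z assume z: "z \<in> fst Z"
    obtain T a b t where T: "T \<in> Coalg" "hom T Z a" "hom T W b"
      "\<forall>s\<in>fst T. l (a s) = k (b s)" "t \<in> fst T" "a t = z"
      using c[OF z] by (auto simp: bisim_def)
    have "h (a s) = \<pi> (b s)" if "s \<in> fst T" for s
      using h[OF hom_fun[OF T(2) that] hom_fun[OF T(3) that]] bisimI[OF T(1-3), of l k s] T(4) that by blast
    then have "hom T P (h \<circ> a)"
      by (intro hom_cong[OF hom_comp[OF T(1) W P T(3) \<pi>]]) simp
    then show "\<exists>T e. T \<in> Coalg \<and> hom T Z e \<and> z \<in> e ` fst T \<and> hom T P (h \<circ> e)"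
      using T by blast
  qed
  moreover have "k (h z) = l z" if "z \<in> fst Z" for z
    using c[OF that] colour bisim_colour by (fastforce simp: h_def)
  ultimately show ?thesis
    by blast
qed

text \<open>
  Two morphisms with the same colours form a span, so they send each element to bisimilar elements.
  Each element of the quotient is bisimilar to its representatives, and bisimilar elements of \<open>W\<close> are
  identified by \<open>\<pi>\<close>.
\<close>

lemma bisim_quotient_separated:
  assumes W: "W \<in> Coalg" and P: "P \<in> Coalg" and \<pi>: "hom W P \<pi>" "\<pi> ` fst W = fst P"
    and colour: "\<forall>w\<in>fst W. k (\<pi> w) = k w"
    and iff: "\<forall>v\<in>fst W. \<forall>w\<in>fst W. \<pi> v = \<pi> w \<longleftrightarrow> bisim W k v W k w"
    and Z: "Z \<in> Coalg" and h: "hom Z P h" "hom Z P h'" "\<forall>z\<in>fst Z. k (h z) = k (h' z)"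
    and z: "z \<in> fst Z"
  shows "h z = h' z"
proof -
  obtain w w' where w: "w \<in> fst W" "h z = \<pi> w" "w' \<in> fst W" "h' z = \<pi> w'"
    using \<pi>(2) hom_fun[OF h(1) z] hom_fun[OF h(2) z] by (metis imageE)
  have 1: "bisim W k v P k (\<pi> v)" if "v \<in> fst W" for v
    using bisim_hom[OF W \<pi>(1)] colour that by metis
  have "bisim P k (h z) P k (h' z)"
    using bisimI[OF Z h(1,2), of k k z] h(3) z by blast
  then have "bisim W k w P k (h' z)"
    using bisim_trans[OF W P P 1[OF w(1)]] w by simp
  then have "bisim W k w W k w'"
    using bisim_trans[OF W P W _ bisim_sym[OF 1[OF w(3)]]] w by simp
  then show ?thesis
    using iff w by simp
qed

text \<open>
  Up to isomorphism, these are all coalgebras of size at most \<open>|K|\<close> with maps to \<open>X\<close> and \<open>Y\<close>. That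
  there are few of them makes their coproduct exist.
\<close>

lemma tiny_coalgebras_below:
  assumes K: "tiny (K :: 'u set)" and X: "tiny X" and Y: "tiny Y"
  shows "tiny {(S, f, g). S \<in> Coalg \<and> fst S \<subseteq> K \<and> f \<in> fst S \<rightarrow>\<^sub>E X \<and> g \<in> fst S \<rightarrow>\<^sub>E Y}"
proof (rule tiny_subset[OF tiny_image])
  let ?D = "SIGMA A:Pow K. (A \<rightarrow>\<^sub>E onOb F A) \<times> (A \<rightarrow>\<^sub>E X) \<times> (A \<rightarrow>\<^sub>E Y)"
  let ?c = "\<lambda>(A, \<alpha>, f, g). (coalg A \<alpha>, f, g)"
  show "tiny ?D"
  proof (rule tiny_Sigma[OF tiny_Pow[OF K]])
    fix A assume "A \<in> Pow K"
    then have A: "small A"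
      using tiny_subset[OF K] by (simp add: small_iff_tiny)
    show "tiny ((A \<rightarrow>\<^sub>E onOb F A) \<times> (A \<rightarrow>\<^sub>E X) \<times> (A \<rightarrow>\<^sub>E Y))"
      using A FO_small[OF A] X Y unfolding small_iff_tiny by (intro tiny_Sigma tiny_PiE) assumption+
  qed
  show "{(S, f, g). S \<in> Coalg \<and> fst S \<subseteq> K \<and> f \<in> fst S \<rightarrow>\<^sub>E X \<and> g \<in> fst S \<rightarrow>\<^sub>E Y} \<subseteq> ?c ` ?D"
  proof clarify
    fix A \<sigma> f g assume S: "(A, \<sigma>) \<in> Coalg" "fst (A, \<sigma>) \<subseteq> K"
      and fg: "f \<in> fst (A, \<sigma>) \<rightarrow>\<^sub>E X" "g \<in> fst (A, \<sigma>) \<rightarrow>\<^sub>E Y"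
    let ?s = "restrict (str (A, \<sigma>)) A"
    have "?s \<in> A \<rightarrow>\<^sub>E onOb F A"
      using CoalgD(2)[OF S(1)] by auto
    moreover have "(A, \<sigma>) = coalg A ?s"
      using CoalgD(4)[OF S(1)] by (simp add: coalg_def)
    ultimately show "((A, \<sigma>), f, g) \<in> ?c ` ?D"
      using S fg by (intro image_eqI[of _ _ "(A, ?s, f, g)"]) auto
  qed
qed

text \<open>
  The product is the quotient of the coproduct \<open>W\<close> by bisimilarity. Boundedness is used to show that
  every element over \<open>X\<close> and \<open>Y\<close> is bisimilar to one in \<open>W\<close>: a small subcoalgebra around it is
  isomorphic to a summand.
\<close>

lemma product_ex:
  assumes bounded: "bounded F" and X: "X \<in> Coalg" and Y: "Y \<in> Coalg"
  obtains P p q where "P \<in> Coalg" "hom P X p" "hom P Y q"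
    "\<forall>Z\<in>Coalg. \<forall>f g. hom Z X f \<longrightarrow> hom Z Y g \<longrightarrow>
       (\<exists>h. hom Z P h \<and> (\<forall>z\<in>fst Z. p (h z) = f z \<and> q (h z) = g z))"
    "\<forall>Z\<in>Coalg. \<forall>h h'. hom Z P h \<longrightarrow> hom Z P h' \<longrightarrow>
       (\<forall>z\<in>fst Z. p (h z) = p (h' z) \<and> q (h z) = q (h' z)) \<longrightarrow> (\<forall>z\<in>fst Z. h z = h' z)"
proof -
  obtain K :: "'u set" where K: "small K"
    and gen: "\<And>Z z. Z \<in> Coalg \<Longrightarrow> z \<in> fst Z \<Longrightarrow> \<exists>S. subcoalgebra F Z S \<and> z \<in> S \<and> |S| \<le>o |K|"
    using bounded unfolding bounded_def by blast
  define I where "I = {(S, f, g). S \<in> Coalg \<and> fst S \<subseteq> K \<and> f \<in> fst S \<rightarrow>\<^sub>E fst X \<and> g \<in> fst S \<rightarrow>\<^sub>E fst Y \<and>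
    hom S X f \<and> hom S Y g}"
  have "tiny I"
    by (rule tiny_subset[OF tiny_coalgebras_below[of K "fst X" "fst Y"]])
      (use K CoalgD(1) X Y in \<open>auto simp: I_def small_iff_tiny\<close>)
  moreover have "fst i \<in> Coalg" if "i \<in> I" for i
    using that by (auto simp: I_def)
  ultimately obtain W \<iota> where W: "W \<in> Coalg" and \<iota>: "\<forall>i\<in>I. hom (fst i) W (\<iota> i)"
    and bij: "bij_betw (\<lambda>(i, s). \<iota> i s) (SIGMA i:I. fst (fst i)) (fst W)"
    by (rule coproduct_ex)
  define dec where "dec = inv_into (SIGMA i:I. fst (fst i)) (\<lambda>(i, s). \<iota> i s)"
  have dec: "dec (\<iota> i s) = (i, s)" if "i \<in> I" "s \<in> fst (fst i)" for i s
    using inv_into_f_f[OF bij_betw_imp_inj_on[OF bij], of "(i, s)"] that by (simp add: dec_def)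
  have cases: "\<exists>i\<in>I. \<exists>s\<in>fst (fst i). w = \<iota> i s" if "w \<in> fst W" for w
    using that bij_betw_imp_surj_on[OF bij, symmetric] by auto
  define p where "p w = (case dec w of (i, s) \<Rightarrow> fst (snd i) s)" for w
  define q where "q w = (case dec w of (i, s) \<Rightarrow> snd (snd i) s)" for w
  let ?k = "\<lambda>w. (p w, q w)"
  have p\<iota>: "p (\<iota> i s) = fst (snd i) s" and q\<iota>: "q (\<iota> i s) = snd (snd i) s"
    if "i \<in> I" "s \<in> fst (fst i)" for i s
    using dec[OF that] by (simp_all add: p_def q_def)
  have homI: "hom (fst i) X (fst (snd i))" "hom (fst i) Y (snd (snd i))" "fst i \<in> Coalg" if "i \<in> I" for i
    using that by (auto simp: I_def)
  \<comment> \<open>morphisms out of the coproduct are glued from the summands\<close>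
  have glue: "hom W V r" if V: "V \<in> Coalg"
    and r: "\<And>i. i \<in> I \<Longrightarrow> hom (fst i) V (r \<circ> \<iota> i)" for V r
  proof (rule hom_local[OF W V])
    show "r \<in> fst W \<rightarrow> fst V"
    proof
      fix w assume "w \<in> fst W"
      then obtain i s where "i \<in> I" "s \<in> fst (fst i)" "w = \<iota> i s"
        using cases by blast
      then show "r w \<in> fst V"
        using hom_fun[OF r] by fastforce
    qed
    fix w assume "w \<in> fst W"
    then show "\<exists>T e. T \<in> Coalg \<and> hom T W e \<and> w \<in> e ` fst T \<and> hom T V (r \<circ> e)"
      using cases r \<iota> homI(3) by blast
  qed
  have pW: "hom W X p"
  proof (rule glue[OF X])
    fix i assume i: "i \<in> I"
    show "hom (fst i) X (p \<circ> \<iota> i)"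
      by (rule hom_cong[OF homI(1)[OF i]]) (simp add: p\<iota>[OF i])
  qed
  have qW: "hom W Y q"
  proof (rule glue[OF Y])
    fix i assume i: "i \<in> I"
    show "hom (fst i) Y (q \<circ> \<iota> i)"
      by (rule hom_cong[OF homI(2)[OF i]]) (simp add: q\<iota>[OF i])
  qed
  obtain P \<pi> where P: "P \<in> Coalg" and \<pi>: "hom W P \<pi>" "\<pi> ` fst W = fst P"
    and colour: "\<forall>w\<in>fst W. ?k (\<pi> w) = ?k w"
    and iff: "\<forall>v\<in>fst W. \<forall>w\<in>fst W. \<pi> v = \<pi> w \<longleftrightarrow> bisim W ?k v W ?k w"
    by (rule bisim_quotient[OF W, of ?k])
  \<comment> \<open>the representatives are elements of \<open>W\<close>, so the projections from \<open>P\<close> are those from \<open>W\<close>\<close>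
  have descend: "hom P V r" if V: "V \<in> Coalg" and r: "hom W V r" "\<forall>w\<in>fst W. r (\<pi> w) = r w" for V r
  proof (rule hom_local[OF P V])
    show "r \<in> fst P \<rightarrow> fst V"
      unfolding \<pi>(2)[symmetric] using r(2) hom_fun[OF r(1)] by auto
    fix x assume "x \<in> fst P"
    moreover have "hom W V (r \<circ> \<pi>)"
      using r by (intro hom_cong[OF r(1)]) simp
    ultimately show "\<exists>T e. T \<in> Coalg \<and> hom T P e \<and> x \<in> e ` fst T \<and> hom T V (r \<circ> e)"
      using W \<pi> by (intro exI[of _ W] exI[of _ \<pi>]) simp
  qed
  have cover: "\<exists>w\<in>fst W. bisim Z (\<lambda>z. (f z, g z)) z W ?k w"
    if Z: "Z \<in> Coalg" and f: "hom Z X f" and g: "hom Z Y g" and z: "z \<in> fst Z" for Z f g z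
  proof -
    obtain S where S: "subcoalgebra F Z S" "z \<in> S" "|S| \<le>o |K|"
      using gen[OF Z z] by blast
    obtain T where T: "T \<in> Coalg" "fst T = S" "hom T Z (\<lambda>x. x)"
      using S(1) Z by (rule subcoalgebraE)
    obtain j where j: "inj_on j S" "j ` S \<subseteq> K"
      using S(3) by (auto simp flip: card_of_ordLeq)
    obtain R where R: "R \<in> Coalg" "fst R = j ` S" "hom T R j" "hom R T (inv_into S j)"
      using transport[OF T(1), of j] j T(2) by metis
    define u where "u = inv_into S j"
    have u: "hom R Z u"
      using hom_comp[OF R(1) T(1) Z R(4) T(3)] by (simp add: u_def comp_def)
    let ?f = "restrict (f \<circ> u) (fst R)" and ?g = "restrict (g \<circ> u) (fst R)"
    have fg: "hom R X ?f" "hom R Y ?g"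
      using hom_cong[OF hom_comp[OF R(1) Z X u f], of ?f] hom_cong[OF hom_comp[OF R(1) Z Y u g], of ?g]
      by auto
    then have i: "(R, ?f, ?g) \<in> I"
      using R j by (auto simp: I_def hom_def Pi_iff)
    have jz: "j z \<in> fst R" "u (j z) = z"
      using R j S by (auto simp: u_def)
    let ?\<iota> = "\<iota> (R, ?f, ?g)"
    have h: "hom R W ?\<iota>"
      using \<iota> i by force
    have "bisim Z (\<lambda>z. (f z, g z)) (u (j z)) W ?k (?\<iota> (j z))"
    proof (rule bisimI[OF R(1) u h _ jz(1)])
      fix s assume "s \<in> fst R"
      then show "(f (u s), g (u s)) = ?k (?\<iota> s)"
        using p\<iota>[OF i] q\<iota>[OF i] by simp
    qed
    then show ?thesis
      using hom_fun[OF h jz(1)] jz(2) by auto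
  qed
  show ?thesis
  proof (rule that[OF P])
    show "hom P X p" "hom P Y q"
      using descend[OF X pW] descend[OF Y qW] colour by auto
    show "\<forall>Z\<in>Coalg. \<forall>f g. hom Z X f \<longrightarrow> hom Z Y g \<longrightarrow>
       (\<exists>h. hom Z P h \<and> (\<forall>z\<in>fst Z. p (h z) = f z \<and> q (h z) = g z))"
    proof (intro ballI allI impI)
      fix Z f g assume Z: "Z \<in> Coalg" "hom Z X f" "hom Z Y g"
      show "\<exists>h. hom Z P h \<and> (\<forall>z\<in>fst Z. p (h z) = f z \<and> q (h z) = g z)"
        using bisim_quotient_terminal[OF W P \<pi>(1) colour iff Z(1) cover[OF Z]] by auto
    qed
    show "\<forall>Z\<in>Coalg. \<forall>h h'. hom Z P h \<longrightarrow> hom Z P h' \<longrightarrow>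
       (\<forall>z\<in>fst Z. p (h z) = p (h' z) \<and> q (h z) = q (h' z)) \<longrightarrow> (\<forall>z\<in>fst Z. h z = h' z)"
      using bisim_quotient_separated[OF W P \<pi> colour iff] by simp
  qed
qed

lemma is_product_ex:
  assumes bounded: "bounded F" and X: "X \<in> Coalg" and Y: "Y \<in> Coalg"
  shows "\<exists>p q. is_product (Set_coalg F) X Y p q"
proof -
  obtain P p q where P: "P \<in> Coalg" and p: "hom P X p" and q: "hom P Y q"
    and ex: "\<forall>Z\<in>Coalg. \<forall>f g. hom Z X f \<longrightarrow> hom Z Y g \<longrightarrow>
       (\<exists>h. hom Z P h \<and> (\<forall>z\<in>fst Z. p (h z) = f z \<and> q (h z) = g z))"
    and sep: "\<forall>Z\<in>Coalg. \<forall>h h'. hom Z P h \<longrightarrow> hom Z P h' \<longrightarrow>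
       (\<forall>z\<in>fst Z. p (h z) = p (h' z) \<and> q (h z) = q (h' z)) \<longrightarrow> (\<forall>z\<in>fst Z. h z = h' z)"
    by (rule product_ex[OF bounded X Y])
  have "is_product (Set_coalg F) X Y (arr P p X) (arr P q Y)"
    unfolding is_product_def
  proof (intro conjI ballI)
    show "arr P p X \<in> Hom (Set_coalg F) (Dom (Set_coalg F) (arr P p X)) X"
      "arr P q Y \<in> Hom (Set_coalg F) (Dom (Set_coalg F) (arr P p X)) Y"
      using P X Y p q by auto
    fix Z f' g' assume Z: "Z \<in> Coalg" and f': "f' \<in> Hom (Set_coalg F) Z X"
      and g': "g' \<in> Hom (Set_coalg F) Z Y"
    obtain f where f: "f' = arr Z f X" "hom Z X f"
      using f' by (rule coalg_HomE)
    obtain g where g: "g' = arr Z g Y" "hom Z Y g"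
      using g' by (rule coalg_HomE)
    obtain h where h: "hom Z P h" "\<forall>z\<in>fst Z. p (h z) = f z \<and> q (h z) = g z"
      using ex Z f g by blast
    show "\<exists>!h. h \<in> Hom (Set_coalg F) Z (Dom (Set_coalg F) (arr P p X)) \<and>
        Cmp (Set_coalg F) (arr P p X) h = f' \<and> Cmp (Set_coalg F) (arr P q Y) h = g'"
    proof (rule ex1I[of _ "arr Z h P"])
      show "arr Z h P \<in> Hom (Set_coalg F) Z (Dom (Set_coalg F) (arr P p X)) \<and>
        Cmp (Set_coalg F) (arr P p X) (arr Z h P) = f' \<and> Cmp (Set_coalg F) (arr P q Y) (arr Z h P) = g'"
        using Z P h f g by simp
    next
      fix k' assume k': "k' \<in> Hom (Set_coalg F) Z (Dom (Set_coalg F) (arr P p X)) \<and>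
        Cmp (Set_coalg F) (arr P p X) k' = f' \<and> Cmp (Set_coalg F) (arr P q Y) k' = g'"
      then have "k' \<in> Hom (Set_coalg F) Z P"
        by simp
      then obtain k where k: "k' = arr Z k P" "hom Z P k"
        by (rule coalg_HomE)
      have "\<forall>z\<in>fst Z. p (k z) = p (h z) \<and> q (k z) = q (h z)"
        using k' k h f g by simp
      then have "\<forall>z\<in>fst Z. k z = h z"
        using sep Z k h by blast
      then show "k' = arr Z h P"
        using k by simp
    qed
  qed
  then show ?thesis
    by blast
qed

lemma binary_products_ex:
  assumes "bounded F"
  shows "\<exists>P. binary_products (Set_coalg F) P"
proof -
  have "\<forall>X Y. \<exists>pq. X \<in> Coalg \<longrightarrow> Y \<in> Coalg \<longrightarrow> is_product (Set_coalg F) X Y (fst pq) (snd pq)"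
    using is_product_ex[OF assms] by (metis fst_conv snd_conv)
  then show ?thesis
    unfolding binary_products_def by metis
qed

end

section \<open>Accessible functors are bounded\<close>

lemma cat_functor_func_comp:
  assumes "cat_functor A B G" "cat_functor B C H"
  shows "cat_functor A C (func_comp H G)"
proof -
  interpret G: cat_functor A B G by (rule assms)
  interpret H: cat_functor B C H by (rule assms)
  show ?thesis
  proof
    show "onAr (func_comp H G) (Cmp A g f) = Cmp C (onAr (func_comp H G) g) (onAr (func_comp H G) f)"
      if "f \<in> Hom A X Y" "g \<in> Hom A Y Z" for f g X Y Z
      using H.onAr_Cmp[OF G.onAr_in[OF that(1)] G.onAr_in[OF that(2)]]
      by (simp add: func_comp_def G.onAr_Cmp[OF that])
  qed (simp_all add: func_comp_def G.onOb_in H.onOb_in G.onAr_in H.onAr_in G.onAr_Ide H.onAr_Ide)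
qed

text \<open>
  The poset of a family \<open>D\<close> of sets under inclusion, as a category. An index category must have its
  objects and arrows in \<open>'u\<close>, so \<open>e\<close> encodes pairs of members of \<open>D\<close>: an inclusion of \<open>S\<close> in \<open>T\<close> is
  encoded as \<open>e (S, T)\<close>, and \<open>S\<close> itself as its identity inclusion \<open>e (S, S)\<close>.
\<close>

definition subset_cat :: "('u set \<times> 'u set \<Rightarrow> 'u) \<Rightarrow> 'u set set \<Rightarrow> ('u, 'u) cat" where
  "subset_cat e D = (let dec = inv_into (D \<times> D) e in \<lparr>
     Ob = {e (S, S) | S. S \<in> D},
     Ar = {e (S, T) | S T. S \<in> D \<and> T \<in> D \<and> S \<subseteq> T},
     Dom = \<lambda>u. e (fst (dec u), fst (dec u)),
     Cod = \<lambda>u. e (snd (dec u), snd (dec u)),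
     Ide = \<lambda>i. i,
     Cmp = \<lambda>v u. e (fst (dec u), snd (dec v))\<rparr>)"

definition inclusion_functor ::
    "('u set \<times> 'u set \<Rightarrow> 'u) \<Rightarrow> 'u set set \<Rightarrow> ('u, 'u, 'u set, 'u smap) func" where
  "inclusion_functor e D = (let dec = inv_into (D \<times> D) e in \<lparr>
     onOb = \<lambda>i. fst (dec i),
     onAr = \<lambda>u. set_arrow (fst (dec u)) (\<lambda>x. x) (snd (dec u))\<rparr>)"

locale subset_diagram =
  fixes e :: "'u set \<times> 'u set \<Rightarrow> 'u" and D :: "'u set set"
  assumes inj: "inj_on e (D \<times> D)"
begin

abbreviation "J \<equiv> subset_cat e D"
abbreviation "G \<equiv> inclusion_functor e D"

lemma dec: "S \<in> D \<Longrightarrow> T \<in> D \<Longrightarrow> inv_into (D \<times> D) e (e (S, T)) = (S, T)"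
  using inj by simp

lemma e_eq: "S \<in> D \<Longrightarrow> T \<in> D \<Longrightarrow> S' \<in> D \<Longrightarrow> T' \<in> D \<Longrightarrow> e (S, T) = e (S', T') \<longleftrightarrow> S = S' \<and> T = T'"
  using inj_on_eq_iff[OF inj, of "(S, T)" "(S', T')"] by simp

lemma J_Ob: "Ob J = {e (S, S) | S. S \<in> D}"
  by (simp add: subset_cat_def Let_def)

lemma J_Hom: "u \<in> Hom J i j \<longleftrightarrow>
    (\<exists>S\<in>D. \<exists>T\<in>D. S \<subseteq> T \<and> u = e (S, T) \<and> i = e (S, S) \<and> j = e (T, T))"
  by (auto simp: Hom_def subset_cat_def Let_def dec) blast

lemma J_Cmp: "S \<in> D \<Longrightarrow> T \<in> D \<Longrightarrow> T' \<in> D \<Longrightarrow> R \<in> D \<Longrightarrow> Cmp J (e (T', R)) (e (S, T)) = e (S, R)"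
  by (simp add: subset_cat_def Let_def dec)

lemma J_Ide: "Ide J i = i"
  by (simp add: subset_cat_def Let_def)

lemma J_Ar: "Ar J = {e (S, T) | S T. S \<in> D \<and> T \<in> D \<and> S \<subseteq> T}"
  by (simp add: subset_cat_def Let_def)

lemma J_Dom: "S \<in> D \<Longrightarrow> T \<in> D \<Longrightarrow> Dom J (e (S, T)) = e (S, S)"
  and J_Cod: "S \<in> D \<Longrightarrow> T \<in> D \<Longrightarrow> Cod J (e (S, T)) = e (T, T)"
  by (simp_all add: subset_cat_def Let_def dec)

lemma G_Ob: "S \<in> D \<Longrightarrow> onOb G (e (S, S)) = S"
  by (simp add: inclusion_functor_def Let_def dec)

lemma G_Ar: "S \<in> D \<Longrightarrow> T \<in> D \<Longrightarrow> onAr G (e (S, T)) = set_arrow S (\<lambda>x. x) T"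
  by (simp add: inclusion_functor_def Let_def dec)

lemma category_J: "category J"
proof
  fix f assume "f \<in> Ar J"
  then obtain S T where "f = e (S, T)" "S \<in> D" "T \<in> D"
    by (auto simp: J_Ar)
  then show "Dom J f \<in> Ob J" "Cod J f \<in> Ob J"
    by (auto simp: J_Dom J_Cod J_Ob)
next
  show "Ide J X \<in> Hom J X X" if "X \<in> Ob J" for X
    using that by (auto simp: J_Ob J_Hom J_Ide)
next
  fix f X Y g Z assume "f \<in> Hom J X Y" "g \<in> Hom J Y Z"
  then show "Cmp J g f \<in> Hom J X Z"
    unfolding J_Hom by (force simp: e_eq J_Cmp)
next
  fix f X Y assume "f \<in> Hom J X Y"
  then show "Cmp J f (Ide J X) = f" "Cmp J (Ide J Y) f = f"
    by (auto simp: J_Hom J_Ide J_Cmp)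
next
  fix f W X g Y h Z assume "f \<in> Hom J W X" "g \<in> Hom J X Y" "h \<in> Hom J Y Z"
  then show "Cmp J (Cmp J h g) f = Cmp J h (Cmp J g f)"
    by (auto simp: J_Hom J_Cmp)
qed

lemma functor_G:
  assumes sets: "category (set_cat :: ('u set, 'u smap) cat)" and small: "\<And>S. S \<in> D \<Longrightarrow> small S"
  shows "cat_functor J set_cat G"
proof -
  interpret J: category J by (rule category_J)
  interpret S: category "set_cat :: ('u set, 'u smap) cat" by (rule sets)
  show ?thesis
  proof
    show "onOb G X \<in> Ob set_cat" if "X \<in> Ob J" for X
      using that small by (auto simp: J_Ob G_Ob)
    show "onAr G f \<in> Hom set_cat (onOb G X) (onOb G Y)" if "f \<in> Hom J X Y" for f X Y
      using that small by (auto simp: J_Hom G_Ob G_Ar)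
    show "onAr G (Ide J X) = Ide set_cat (onOb G X)" if "X \<in> Ob J" for X
      using that by (auto simp: J_Ob G_Ob G_Ar J_Ide)
    show "onAr G (Cmp J g f) = Cmp set_cat (onAr G g) (onAr G f)"
      if fg: "f \<in> Hom J X Y" "g \<in> Hom J Y Z" for f g X Y Z
    proof -
      obtain A B B' C where f: "f = e (A, B)" "A \<in> D" "B \<in> D" "A \<subseteq> B" "Y = e (B, B)"
        and g: "g = e (B', C)" "B' \<in> D" "C \<in> D" "Y = e (B', B')"
        using fg unfolding J_Hom by blast
      have "B' = B"
        using f g by (simp add: e_eq)
      moreover have "(\<lambda>x. x) \<in> A \<rightarrow> B"
        using f by auto
      ultimately show ?thesis
        using f g by (simp add: J_Cmp G_Ar comp_def)
    qed
  qed
qed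

text \<open>
  A cocone is determined by its values on the singletons, through which every element of every member
  of \<open>D\<close> factors.
\<close>

lemma colimit_G:
  assumes X: "small X" and D: "\<And>S. S \<in> D \<Longrightarrow> S \<subseteq> X" "\<And>x. x \<in> X \<Longrightarrow> {x} \<in> D"
    and small: "\<And>S. S \<in> D \<Longrightarrow> small S"
  shows "colimit J set_cat G X (\<lambda>i. set_arrow (onOb G i) (\<lambda>x. x) X)" (is "colimit _ _ _ _ ?l")
  unfolding colimit_def
proof (intro conjI allI impI)
  show "cocone J set_cat G X ?l"
    unfolding cocone_def
  proof (intro conjI ballI)
    show "?l i \<in> Hom set_cat (onOb G i) X" if i: "i \<in> Ob J" for i
    proof -
      obtain S where S: "i = e (S, S)" "S \<in> D"
        using i by (auto simp: J_Ob)
      then show ?thesis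
        using X D(1)[OF S(2)] small[OF S(2)] by (auto simp: G_Ob)
    qed
    fix u assume "u \<in> Ar J"
    then obtain S T where u: "u = e (S, T)" "S \<in> D" "T \<in> D" "S \<subseteq> T"
      by (auto simp: J_Ar)
    then have "(\<lambda>x. x) \<in> S \<rightarrow> T"
      by auto
    then show "Cmp set_cat (?l (Cod J u)) (onAr G u) = ?l (Dom J u)"
      using u by (simp add: J_Cod J_Dom G_Ar G_Ob)
  qed (use X in simp)
  fix c' l' assume co: "cocone J set_cat G c' l'"
  have "\<exists>k. l' (e (S, S)) = set_arrow S k c' \<and> k \<in> S \<rightarrow> c'" if S: "S \<in> D" for S
  proof -
    have "l' (e (S, S)) \<in> Hom set_cat S c'"
      using co S G_Ob[OF S] by (auto simp: cocone_def J_Ob)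
    then show ?thesis
      by (auto elim: set_HomE)
  qed
  then obtain k where k: "\<And>S. S \<in> D \<Longrightarrow> l' (e (S, S)) = set_arrow S (k S) c' \<and> k S \<in> S \<rightarrow> c'"
    by metis
  define h where "h x = k {x} x" for x
  have kh: "k S x = h x" if S: "S \<in> D" and x: "x \<in> S" for S x
  proof -
    have xD: "{x} \<in> D"
      using D S x by blast
    have u: "e ({x}, S) \<in> Ar J"
      using S xD x by (auto simp: J_Ar)
    have "Cmp set_cat (l' (Cod J (e ({x}, S)))) (onAr G (e ({x}, S))) = l' (Dom J (e ({x}, S)))"
      using co u unfolding cocone_def by blast
    then have "Cmp set_cat (l' (e (S, S))) (set_arrow {x} (\<lambda>x. x) S) = l' (e ({x}, {x}))"
      unfolding J_Cod[OF xD S] J_Dom[OF xD S] G_Ar[OF xD S] .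
    then show ?thesis
      using k[OF S] k[OF xD] x by (simp add: h_def)
  qed
  show "\<exists>!h. h \<in> Hom set_cat X c' \<and> (\<forall>i\<in>Ob J. Cmp set_cat h (?l i) = l' i)"
  proof (rule ex1I[of _ "set_arrow X h c'"])
    have "h \<in> X \<rightarrow> c'"
      using k[OF D(2)] by (auto simp: h_def)
    moreover have "Cmp set_cat (set_arrow X h c') (?l i) = l' i" if i: "i \<in> Ob J" for i
    proof -
      obtain S where S: "i = e (S, S)" "S \<in> D"
        using i by (auto simp: J_Ob)
      then have "(\<lambda>x. x) \<in> S \<rightarrow> X"
        using D by auto
      then show ?thesis
        using S k[OF S(2)] kh[OF S(2)] by (simp add: G_Ob)
    qed
    moreover have "small c'"
      using co by (simp add: cocone_def)
    ultimately show "set_arrow X h c' \<in> Hom set_cat X c' \<and>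
        (\<forall>i\<in>Ob J. Cmp set_cat (set_arrow X h c') (?l i) = l' i)"
      using X by simp
  next
    fix g' assume g': "g' \<in> Hom set_cat X c' \<and> (\<forall>i\<in>Ob J. Cmp set_cat g' (?l i) = l' i)"
    then obtain g where g: "g' = set_arrow X g c'" "g \<in> X \<rightarrow> c'"
      by (auto elim: set_HomE)
    have "g x = h x" if x: "x \<in> X" for x
    proof -
      have xD: "{x} \<in> D"
        using D(2)[OF x] .
      have "Cmp set_cat g' (?l (e ({x}, {x}))) = l' (e ({x}, {x}))"
        using g' xD by (auto simp: J_Ob)
      moreover have "(\<lambda>x. x) \<in> {x} \<rightarrow> X"
        using x by auto
      ultimately show ?thesis
        using k[OF xD] g xD by (simp add: G_Ob h_def)
    qed
    then show "g' = set_arrow X h c'"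
      using g by simp
  qed
qed

text \<open>
  A category has no more objects than arrows, so a diagram with few arrows meets few members of
  \<open>D\<close>, and these have an upper bound.
\<close>

lemma filtered_J:
  assumes dir: "\<And>V. V \<subseteq> D \<Longrightarrow> |V| <o |K :: 'u set| \<Longrightarrow> \<exists>T\<in>D. \<Union>V \<subseteq> T"
  shows "filtered K J"
  unfolding filtered_def
proof (intro conjI allI impI)
  show "category J"
    by (rule category_J)
  fix I :: "('u, 'u) cat" and E
  assume card: "|Ar I| <o |K|" and E: "cat_functor I J E"
  interpret E: cat_functor I J E by (rule E)
  have "inj_on (Ide I) (Ob I)"
    using E.C.Ide_in by (intro inj_onI) (metis Hom_D)
  moreover have "Ide I ` Ob I \<subseteq> Ar I"
    using E.C.Ide_in by (auto simp: Hom_def)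
  ultimately have "|Ob I| \<le>o |Ar I|"
    using card_of_ordLeq by blast
  then have "|Ob I| <o |K|"
    using card ordLeq_ordLess_trans by blast
  then have "|(\<lambda>i. onOb G (onOb E i)) ` Ob I| <o |K|"
    using card_of_image ordLeq_ordLess_trans by blast
  moreover have ED: "onOb G (onOb E i) \<in> D \<and> onOb E i = e (onOb G (onOb E i), onOb G (onOb E i))"
    if "i \<in> Ob I" for i
    using E.onOb_in[OF that] by (auto simp: J_Ob G_Ob)
  ultimately obtain T where T: "T \<in> D" "\<Union>((\<lambda>i. onOb G (onOb E i)) ` Ob I) \<subseteq> T"
    using dir[of "(\<lambda>i. onOb G (onOb E i)) ` Ob I"] by blast
  let ?l = "\<lambda>i. e (onOb G (onOb E i), T)"
  have "cocone I J E (e (T, T)) ?l"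
    unfolding cocone_def
  proof (intro conjI ballI)
    show "e (T, T) \<in> Ob J"
      using T by (auto simp: J_Ob)
    show "?l i \<in> Hom J (onOb E i) (e (T, T))" if "i \<in> Ob I" for i
      using ED[OF that] T that unfolding J_Hom by blast
    fix u assume u: "u \<in> Ar I"
    then have "u \<in> Hom I (Dom I u) (Cod I u)"
      by (simp add: Hom_def)
    then have "onAr E u \<in> Hom J (onOb E (Dom I u)) (onOb E (Cod I u))"
      by (rule E.onAr_in)
    then obtain A B where AB: "A \<in> D" "B \<in> D" "onAr E u = e (A, B)"
      "onOb E (Dom I u) = e (A, A)" "onOb E (Cod I u) = e (B, B)"
      by (auto simp: J_Hom)
    then show "Cmp J (?l (Cod I u)) (onAr E u) = ?l (Dom I u)"
      using T by (simp add: G_Ob J_Cmp)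
  qed
  then show "\<exists>c l. cocone I J E c l"
    by blast
qed

end

context wpb_endofunctor
begin

text \<open>
  An element outside the images of all legs could be separated from them by two different maps to a
  two-element set.
\<close>

lemma colimit_jointly_surj:
  assumes D: "cat_functor J set_cat D"
    and col: "colimit J set_cat D (A :: 'u set) l" and y: "y \<in> A"
  shows "\<exists>i\<in>Ob J. y \<in> under (l i) ` onOb D i"
proof (rule ccontr)
  assume n: "\<not> ?thesis"
  interpret D: cat_functor J set_cat D by (rule D)
  have co: "cocone J set_cat D A l"
    using col by (simp add: colimit_def)
  have A: "small A"
    using co by (simp add: cocone_def)
  have "\<exists>b. b \<notin> {y}"
    using infinite_U by (intro ex_new_if_finite) auto
  then obtain b where b: "b \<noteq> y"
    by auto
  have s: "small {y, b}"
    by (simp add: small_iff_tiny tiny_finite)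
  define c where "c = set_arrow A (\<lambda>_. b) {y, b}"
  define d where "d = set_arrow A (\<lambda>x. if x = y then y else b) {y, b}"
  have c: "c \<in> Hom set_cat A {y, b}" and d: "d \<in> Hom set_cat A {y, b}"
    using A s by (auto simp: c_def d_def)
  have li: "l i \<in> Hom set_cat (onOb D i) A" if "i \<in> Ob J" for i
    using co that by (simp add: cocone_def)
  have eq: "Cmp set_cat d (l i) = Cmp set_cat c (l i)" if i: "i \<in> Ob J" for i
  proof -
    obtain k where k: "l i = set_arrow (onOb D i) k A" "k \<in> onOb D i \<rightarrow> A"
      by (rule set_HomE[OF li[OF i]]) (rule that)
    moreover have "k x \<noteq> y" if x: "x \<in> onOb D i" for x
    proof -
      have "under (l i) x = k x"
        using k(1) x by simp
      then show ?thesis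
        using n i x by (metis imageI)
    qed
    ultimately show ?thesis
      by (simp add: c_def d_def)
  qed
  have "cocone J set_cat D {y, b} (\<lambda>i. Cmp set_cat c (l i))"
    unfolding cocone_def
  proof (intro conjI ballI)
    show "Cmp set_cat c (l i) \<in> Hom set_cat (onOb D i) {y, b}" if "i \<in> Ob J" for i
      using li[OF that] c by (rule C.Cmp_in)
    fix u assume u: "u \<in> Ar J"
    have Du: "onAr D u \<in> Hom set_cat (onOb D (Dom J u)) (onOb D (Cod J u))"
      using u by (intro D.onAr_in) (simp add: Hom_def)
    have "Cmp set_cat (l (Cod J u)) (onAr D u) = l (Dom J u)"
      using co u by (simp add: cocone_def)
    then show "Cmp set_cat (Cmp set_cat c (l (Cod J u))) (onAr D u) = Cmp set_cat c (l (Dom J u))"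
      using C.Cmp_assoc[OF Du li[OF D.C.Cod_in[OF u]] c] by simp
  qed (use s in simp)
  then have "\<exists>!h. h \<in> Hom set_cat A {y, b} \<and> (\<forall>i\<in>Ob J. Cmp set_cat h (l i) = Cmp set_cat c (l i))"
    using col unfolding colimit_def by blast
  then have "c = d"
    using c d eq by metis
  then show False
    using y b by (auto simp: c_def d_def)
qed

text \<open>
  \<open>X\<close> is the colimit of its subsets of size less than \<open>|K|\<close>, and this poset is \<open>|K|\<close>-filtered as
  \<open>|K|\<close> is regular. Hence \<open>F X\<close> is the colimit of the images of these subsets under \<open>F\<close>, and the
  legs of a colimit are jointly surjective.
\<close>

lemma accessible_support:
  assumes K: "infinite (K :: 'u set)" "regularCard |K|"
    and pres: "\<forall>(J :: ('u, 'u) cat) D c l. small_cat J \<longrightarrow> filtered K J \<longrightarrow> cat_functor J set_cat D \<longrightarrow>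
        colimit J set_cat D c l \<longrightarrow> colimit J set_cat (func_comp F D) (onOb F c) (onAr F \<circ> l)"
    and X: "small X" and y: "y \<in> onOb F X"
  obtains S where "S \<subseteq> X" "|S| <o |K|" "y \<in> Fm S X (\<lambda>x. x) ` onOb F S"
proof -
  define D where "D = {S. S \<subseteq> X \<and> |S| <o |K|}"
  have tX: "tiny X"
    using X by (simp add: small_iff_tiny)
  have smallD: "small S" if "S \<in> D" for S
    using that tiny_subset[OF tX] by (auto simp: D_def small_iff_tiny)
  have "tiny D"
    by (rule tiny_subset[OF tiny_Pow[OF tX]]) (auto simp: D_def)
  then have tDD: "tiny (D \<times> D)"
    by (intro tiny_Sigma)
  then obtain e :: "'u set \<times> 'u set \<Rightarrow> 'u" where e: "inj_on e (D \<times> D)" "small (e ` (D \<times> D))"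
    by (rule tiny_encode)
  interpret subset_diagram e D
    by standard (rule e)
  have sub: "Ob J \<subseteq> e ` (D \<times> D)" "Ar J \<subseteq> e ` (D \<times> D)"
    by (auto simp: J_Ob J_Ar)
  have smallJ: "small_cat J"
    using category_J e(2) tiny_subset[OF _ sub(1)] tiny_subset[OF _ sub(2)]
    by (simp add: small_cat_def small_iff_tiny)
  have filt: "filtered K J"
  proof (rule filtered_J)
    fix V assume V: "V \<subseteq> D" "|V| <o |K|"
    have "|SIGMA S:V. S| <o |K|"
      using V by (intro stable_elim[OF stable_card[OF K]]) (auto simp: D_def)
    moreover have "\<Union>V = snd ` (SIGMA S:V. S)"
      by force
    ultimately have "|\<Union>V| <o |K|"
      using card_of_image ordLeq_ordLess_trans by metis
    then show "\<exists>T\<in>D. \<Union>V \<subseteq> T"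
      using V by (intro bexI[of _ "\<Union>V"]) (auto simp: D_def)
  qed
  have funG: "cat_functor J set_cat G"
    using C.category_axioms smallD by (rule functor_G)
  have "{x} \<in> D" if "x \<in> X" for x
    using that K(1) finite_ordLess_infinite[OF card_of_Well_order[of "{x}"] card_of_Well_order[of K]]
    by (simp add: D_def Field_card_of)
  then have "colimit J set_cat G X (\<lambda>i. set_arrow (onOb G i) (\<lambda>x. x) X)"
    using X smallD by (intro colimit_G) (auto simp: D_def)
  then have col: "colimit J set_cat (func_comp F G) (onOb F X)
      (onAr F \<circ> (\<lambda>i. set_arrow (onOb G i) (\<lambda>x. x) X))"
    using pres smallJ filt funG by blast
  obtain i where i: "i \<in> Ob J"
    "y \<in> under ((onAr F \<circ> (\<lambda>i. set_arrow (onOb G i) (\<lambda>x. x) X)) i) ` onOb (func_comp F G) i"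
    using colimit_jointly_surj[OF cat_functor_func_comp[OF funG cat_functor_axioms] col y] by blast
  then obtain S where S: "i = e (S, S)" "S \<in> D"
    by (auto simp: J_Ob)
  then have "y \<in> Fm S X (\<lambda>x. x) ` onOb F S"
    using i(2) by (simp add: G_Ob Fm_def func_comp_def)
  then show ?thesis
    using that S(2) by (auto simp: D_def)
qed

text \<open>
  Starting from \<open>{x}\<close>, add the supports of the structure at all elements, countably often. The union is
  closed under supports, hence a subcoalgebra.
\<close>

lemma accessible_imp_bounded:
  assumes "accessible F"
  shows "bounded F"
proof -
  obtain K :: "'u set" where sK: "small K" and K: "infinite K" "regularCard |K|"
    and pres: "\<forall>(J :: ('u, 'u) cat) D c l. small_cat J \<longrightarrow> filtered K J \<longrightarrow> cat_functor J set_cat D \<longrightarrow>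
        colimit J set_cat D c l \<longrightarrow> colimit J set_cat (func_comp F D) (onOb F c) (onAr F \<circ> l)"
    using assms unfolding accessible_def by blast
  have "\<exists>S. subcoalgebra F X S \<and> x \<in> S \<and> |S| \<le>o |K|" if X: "X \<in> Coalg" and x: "x \<in> fst X" for X x
  proof -
    note sX = CoalgD(1)[OF X]
    have "\<exists>S. S \<subseteq> fst X \<and> |S| <o |K| \<and> str X a \<in> Fm S (fst X) (\<lambda>x. x) ` onOb F S" if "a \<in> fst X" for a
      by (rule accessible_support[OF K pres sX str_in[OF X that]]) blast
    then obtain supp where supp: "\<And>a. a \<in> fst X \<Longrightarrow> supp a \<subseteq> fst X \<and> |supp a| <o |K| \<and>
        str X a \<in> Fm (supp a) (fst X) (\<lambda>x. x) ` onOb F (supp a)"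
      by metis
    define N where "N = rec_nat {x} (\<lambda>_ A. \<Union>a\<in>A. supp a)"
    have N: "N 0 = {x}" "N (Suc n) = (\<Union>a\<in>N n. supp a)" for n
      by (simp_all add: N_def)
    have NX: "N n \<subseteq> fst X \<and> |N n| \<le>o |K|" for n
    proof (induction n)
      case 0
      have "|{x}| <o |K|"
        using K(1) finite_ordLess_infinite[OF card_of_Well_order[of "{x}"] card_of_Well_order[of K]]
        by (simp add: Field_card_of)
      then show ?case
        using x by (simp add: N ordLess_imp_ordLeq)
    next
      case (Suc n)
      have "|\<Union>a\<in>N n. supp a| \<le>o |K|"
        using Suc supp K(1) by (intro card_of_UNION_ordLeq_infinite) (auto intro!: ordLess_imp_ordLeq)
      then show ?case
        using Suc supp by (auto simp: N)
    qed
    define S where "S = (\<Union>n. N n)"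
    have card: "|S| \<le>o |K|"
      unfolding S_def using NX K(1)
      by (intro card_of_UNION_ordLeq_infinite) (auto simp flip: infinite_iff_card_of_nat)
    have SX: "S \<subseteq> fst X" and xS: "x \<in> S"
      using NX N(1) by (auto simp: S_def)
    have closed: "supp a \<subseteq> S" if "a \<in> S" for a
      using that N(2) by (fastforce simp: S_def)
    have sS: "small S"
      using sX tiny_subset[OF _ SX] by (simp add: small_iff_tiny)
    have "\<exists>u\<in>onOb F S. Fm S (fst X) (\<lambda>x. x) u = str X a" if a: "a \<in> S" for a
    proof -
      have aX: "a \<in> fst X"
        using a SX by blast
      obtain v where v: "v \<in> onOb F (supp a)" "Fm (supp a) (fst X) (\<lambda>x. x) v = str X a"
        using supp[OF aX] by auto
      have ss: "small (supp a)"
        using sX tiny_subset[of "fst X" "supp a"] supp[OF aX] by (simp add: small_iff_tiny)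
      have incl: "(\<lambda>x. x) \<in> supp a \<rightarrow> S" "(\<lambda>x. x) \<in> S \<rightarrow> fst X"
        using closed[OF a] SX by auto
      have "Fm S (fst X) (\<lambda>x. x) (Fm (supp a) S (\<lambda>x. x) v) = str X a"
        using Fm_comp[OF ss sS sX incl v(1)] v(2) by (simp add: comp_def)
      moreover have "Fm (supp a) S (\<lambda>x. x) v \<in> onOb F S"
        using Fm_in[OF ss sS incl(1)] v(1) by auto
      ultimately show ?thesis
        by blast
    qed
    then obtain \<sigma> where \<sigma>: "\<And>a. a \<in> S \<Longrightarrow> \<sigma> a \<in> onOb F S \<and> Fm S (fst X) (\<lambda>x. x) (\<sigma> a) = str X a"
      by metis
    have "coalg S \<sigma> \<in> Coalg"
      using sS \<sigma> by (intro coalg_in) auto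
    moreover have "hom (coalg S \<sigma>) X (\<lambda>x. x)"
      using \<sigma> SX by (auto simp: hom_def)
    ultimately have "arr (coalg S \<sigma>) (\<lambda>x. x) X \<in> Ar (Set_coalg F)"
      using X by simp
    then have "subcoalgebra F X S"
      using SX unfolding subcoalgebra_def arr_def by (auto simp: coalg_def)
    then show ?thesis
      using xS card by blast
  qed
  then show ?thesis
    unfolding bounded_def using sK by blast
qed

end

section \<open>Embedding and product bifunctor\<close>

theorem proposition1p2:
  fixes F :: "'u set_endo"
  assumes "universe TYPE('u)"
    and "cat_functor set_cat set_cat F"
    and "nontrivial F"
    and "weakly_preserves_pullbacks set_cat set_cat F"
    and "bounded F \<or> accessible F"
  shows "\<exists>J. faithful_embedding (Set_coalg F) (pfn_cat (Set_coalg F)) J \<and>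
    (\<forall>X\<in>Ob (Set_coalg F). onOb J X = X) \<and>
    (\<forall>\<phi>\<in>Ar (Set_coalg F).
       onAr J \<phi> = pfn_class (Set_coalg F) (Ide (Set_coalg F) (Dom (Set_coalg F) \<phi>)) \<phi>) \<and>
    (\<exists>P. binary_products (Set_coalg F) P) \<and>
    (\<forall>P. binary_products (Set_coalg F) P \<longrightarrow>
      (\<exists>T. cat_functor (prod_cat (pfn_cat (Set_coalg F)) (pfn_cat (Set_coalg F)))
             (pfn_cat (Set_coalg F)) T \<and>
        (\<forall>X\<in>Ob (Set_coalg F). \<forall>Y\<in>Ob (Set_coalg F).
           onOb T (X, Y) = prod_ob (Set_coalg F) P X Y) \<and>
        (\<forall>(m, \<phi>)\<in>spans (Set_coalg F). \<forall>(m', \<phi>')\<in>spans (Set_coalg F).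
           onAr T (pfn_class (Set_coalg F) m \<phi>, pfn_class (Set_coalg F) m' \<phi>') =
           pfn_class (Set_coalg F) (prod_ar (Set_coalg F) P m m') (prod_ar (Set_coalg F) P \<phi> \<phi>')) \<and>
        (\<forall>\<phi>\<in>Ar (Set_coalg F). \<forall>\<psi>\<in>Ar (Set_coalg F).
           onAr T (onAr J \<phi>, onAr J \<psi>) = onAr J (prod_ar (Set_coalg F) P \<phi> \<psi>))))"
proof -
  interpret F: cat_functor set_cat set_cat F
    by (rule assms)
  interpret wpb_endofunctor "TYPE('u)" F
    by unfold_locales (use assms in auto)
  interpret pb: category_with_monic_pullbacks "Set_coalg F"
  proof (rule category_with_monic_pullbacks.intro)
    show "category (Set_coalg F)"
      by (rule coalg_category[OF assms(2)])
    show "category_with_monic_pullbacks_axioms (Set_coalg F)"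
      by standard (rule monic_pullback)
  qed
  have bounded: "bounded F"
    using assms(5) accessible_imp_bounded by blast
  show ?thesis
  proof (intro exI[of _ pb.total_functor] conjI allI impI)
    show "faithful_embedding (Set_coalg F) (pfn_cat (Set_coalg F)) pb.total_functor"
      by (rule pb.total_faithful_embedding)
    show "\<forall>X\<in>Ob (Set_coalg F). onOb pb.total_functor X = X"
      "\<forall>\<phi>\<in>Ar (Set_coalg F). onAr pb.total_functor \<phi> =
         pfn_class (Set_coalg F) (Ide (Set_coalg F) (Dom (Set_coalg F) \<phi>)) \<phi>"
      by (simp_all add: pb.total_functor_def)
    show "\<exists>P. binary_products (Set_coalg F) P"
      using bounded by (rule binary_products_ex)
    fix P assume P: "binary_products (Set_coalg F) P"
    interpret pr: category_with_monic_pullbacks_and_products "Set_coalg F" P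
      by unfold_locales (rule P)
    show "\<exists>T. cat_functor (prod_cat (pfn_cat (Set_coalg F)) (pfn_cat (Set_coalg F)))
             (pfn_cat (Set_coalg F)) T \<and>
        (\<forall>X\<in>Ob (Set_coalg F). \<forall>Y\<in>Ob (Set_coalg F).
           onOb T (X, Y) = prod_ob (Set_coalg F) P X Y) \<and>
        (\<forall>(m, \<phi>)\<in>spans (Set_coalg F). \<forall>(m', \<phi>')\<in>spans (Set_coalg F).
           onAr T (pfn_class (Set_coalg F) m \<phi>, pfn_class (Set_coalg F) m' \<phi>') =
           pfn_class (Set_coalg F) (prod_ar (Set_coalg F) P m m') (prod_ar (Set_coalg F) P \<phi> \<phi>')) \<and>
        (\<forall>\<phi>\<in>Ar (Set_coalg F). \<forall>\<psi>\<in>Ar (Set_coalg F).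
           onAr T (onAr pb.total_functor \<phi>, onAr pb.total_functor \<psi>) =
           onAr pb.total_functor (prod_ar (Set_coalg F) P \<phi> \<psi>))"
    proof (intro exI[of _ pr.pfn_prod] conjI)
      show "\<forall>(m, \<phi>)\<in>spans (Set_coalg F). \<forall>(m', \<phi>')\<in>spans (Set_coalg F).
           onAr pr.pfn_prod (pfn_class (Set_coalg F) m \<phi>, pfn_class (Set_coalg F) m' \<phi>') =
           pfn_class (Set_coalg F) (prod_ar (Set_coalg F) P m m') (prod_ar (Set_coalg F) P \<phi> \<phi>')"
        using pr.pfn_prod_class by blast
    qed (use pr.pfn_prod_functor pr.pfn_prod_ob pr.pfn_prod_total in auto)
  qed
qed

end
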